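(* For each $m\in\mathbb{N}_0$, the augmented Plancherel growth process initiated at time $m$, $(\Lambda_m^{(t)})_{t\ge m}$, is a Markov chain with transition probabilities given for any $t\ge m$ and any $\Lambda,\widetilde\Lambda\in\mathbb{Y}^*$ with regular parts $\lambda,\widetilde\lambda$ by \[ \mathbb{P}\left(\Lambda_m^{(t+1)}=\widetilde\Lambda\ \middle|\ \Lambda_m^{(t)}=\Lambda\right)=\begin{cases}\mathbb{P}\left(\lambda^{(t+1)}=\widetilde\lambda\ \middle|\ \lambda^{(t)}=\lambda\right)&\text{if }\Lambda\nearrow\widetilde\Lambda,\\ 0&\text{otherwise},\end{cases} \] where the conditional probability on the right-hand side is the transition probability of the Plancherel growth process $(\lambda^{(n)})_{n\ge 0}$. In particular these transition probabilities do not depend on $m$.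
   Context: Boxes are identified with coordinates $(x,y)\in\mathbb{N}_0^2$ of their lower-left corners (French convention; $x$ = column, $y$ = row, row $0$ at the bottom). Schensted row insertion $\mathcal{T}\leftarrow a$: $a$ is inserted into row $0$ into the leftmost box with entry strictly bigger than $a$; if none, $a$ goes into the leftmost empty box of the row and the procedure stops; otherwise the previous content is bumped into row $1$ and inserted there by the same rule, etc. $P(w_1,\dots,w_\ell)=(\cdots(\emptyset\leftarrow w_1)\cdots)\leftarrow w_\ell$ and $\mathrm{RSK}(w)$ is its shape. Let $\xi_1,\xi_2,\dots$ be i.i.d. uniform on $[0,1]$; the Plancherel growth process is $\lambda^{(n)}=\mathrm{RSK}(\xi_1,\dots,\xi_n)$, $n\ge0$ (a Markov chain on Young diagrams). $\lambda\nearrow\widetilde\lambda$ means $\widetilde\lambda$ is obtained from $\lambda$ by adding a box. An outer corner of $\lambda$ is a box not in $\lambda$ whose addition gives a Young diagram. $\mathbb{Y}^*$ is the set of augmented Young diagrams $(\lambda,\Box)$ ($\lambda$ a Young diagram, called the regular part; $\Box$ an outer corner of $\lambda$, the special box). Augmented Young graph: $(\lambda,\Box)\nearrow(\widetilde\lambda,\widetilde\Box)$ iff $\lambda\nearrow\widetilde\lambda$ and $\widetilde\Box$ is the outer corner of $\widetilde\lambda$ in the row directly above $\Box$ if $\widetilde\lambda/\lambda=\{\Box\}$, while $\widetilde\Box=\Box$ otherwise. For a tableau $\mathcal{T}$ with exactly one entry $\infty$ (a symbol bigger than all other entries), $\operatorname{sh}^*\mathcal{T}=(\text{shape of }\mathcal{T}\text{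 without the box of }\infty,\ \text{position of }\infty)$. The augmented Plancherel growth process initiated at time $m$ is $\Lambda_m^{(t)}=\operatorname{sh}^*P(\xi_1,\dots,\xi_m,\infty,\xi_{m+1},\dots,\xi_t)$ for integers $t\ge m$. *)

theory Defs
  imports "HOL-Probability.Probability"
begin

text \<open>A tableau is the list of its rows, row \<open>0\<close> first; boxes are pairs \<open>(x, y)\<close> of column
  and row. The second component of \<^term>\<open>row_insert\<close> below is the bumped entry, if any.\<close>

fun row_insert :: "'a::linorder list \<Rightarrow> 'a \<Rightarrow> 'a list \<times> 'a option" where
  "row_insert [] a = ([a], None)"
| "row_insert (x # xs) a =
     (if a < x then (a # xs, Some x)
      else (case row_insert xs a of (ys, b) \<Rightarrow> (x # ys, b)))"

fun schensted_insert :: "'a::linorder list list \<Rightarrow> 'a \<Rightarrow> 'a list list" where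
  "schensted_insert [] a = [[a]]"
| "schensted_insert (r # rs) a =
     (case row_insert r a of
        (r', None) \<Rightarrow> r' # rs
      | (r', Some b) \<Rightarrow> r' # schensted_insert rs b)"

definition P_tableau :: "'a::linorder list \<Rightarrow> 'a list list" where
  "P_tableau w = foldl schensted_insert [] w"

type_synonym box = "nat \<times> nat"

definition shape :: "'a list list \<Rightarrow> box set" where
  "shape T = {(x, y). y < length T \<and> x < length (T ! y)}"

definition entry :: "'a list list \<Rightarrow> box \<Rightarrow> 'a" where
  "entry T b = T ! snd b ! fst b"

definition RSK :: "'a::linorder list \<Rightarrow> box set" where
  "RSK w = shape (P_tableau w)"

definition young_diagram :: "box set \<Rightarrow> bool" where
  "young_diagram D \<longleftrightarrow>
     finite D \<and> (\<forall>x y x' y'. (x, y) \<in> D \<longrightarrow> x' \<le> x \<longrightarrow> y' \<le> y \<longrightarrow> (x', y') \<in> D)"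

definition outer_corner :: "box set \<Rightarrow> box \<Rightarrow> bool" where
  "outer_corner D b \<longleftrightarrow> b \<notin> D \<and> young_diagram (insert b D)"

definition young_edge :: "box set \<Rightarrow> box set \<Rightarrow> bool" where
  "young_edge D D' \<longleftrightarrow>
     young_diagram D \<and> young_diagram D' \<and> (\<exists>b. b \<notin> D \<and> D' = insert b D)"

type_synonym aug_diagram = "box set \<times> box"

definition augmented_diagrams :: "aug_diagram set" where
  "augmented_diagrams = {(D, b). young_diagram D \<and> outer_corner D b}"

definition augmented_edge :: "aug_diagram \<Rightarrow> aug_diagram \<Rightarrow> bool" where
  "augmented_edge L L' \<longleftrightarrow>
     L \<in> augmented_diagrams \<and> L' \<in> augmented_diagrams \<and>
     young_edge (fst L) (fst L') \<and>
     (if fst L' - fst L = {snd L}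
      then outer_corner (fst L') (snd L') \<and> snd (snd L') = Suc (snd (snd L))
      else snd L' = snd L)"

text \<open>Meaningful only for tableaux with exactly one entry \<open>\<infinity>\<close>.\<close>

definition augmented_shape :: "ereal list list \<Rightarrow> aug_diagram" where
  "augmented_shape T =
     (let b = (THE b. b \<in> shape T \<and> entry T b = \<infinity>) in (shape T - {b}, b))"

text \<open>The sequence \<open>\<xi>\<close> is indexed from \<open>1\<close>; the value \<open>\<xi> 0\<close> is never used.\<close>

definition plancherel_growth :: "(nat \<Rightarrow> 'a \<Rightarrow> real) \<Rightarrow> nat \<Rightarrow> 'a \<Rightarrow> box set" where
  "plancherel_growth \<xi> n \<omega> = RSK (map (\<lambda>i. \<xi> i \<omega>) [1..<Suc n])"

definition augmented_plancherel_growth ::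
    "(nat \<Rightarrow> 'a \<Rightarrow> real) \<Rightarrow> nat \<Rightarrow> nat \<Rightarrow> 'a \<Rightarrow> aug_diagram" where
  "augmented_plancherel_growth \<xi> m t \<omega> =
     augmented_shape (P_tableau
       (map (\<lambda>i. ereal (\<xi> i \<omega>)) [1..<Suc m] @ [\<infinity>] @
        map (\<lambda>i. ereal (\<xi> i \<omega>)) [Suc m..<Suc t]))"

definition iid_uniform :: "'a measure \<Rightarrow> (nat \<Rightarrow> 'a \<Rightarrow> real) \<Rightarrow> bool" where
  "iid_uniform M \<xi> \<longleftrightarrow>
     prob_space M \<and>
     prob_space.indep_vars M (\<lambda>_. borel) \<xi> {1..} \<and>
     (\<forall>i\<ge>1. distr M borel (\<xi> i) = uniform_measure lborel {0..1})"

text \<open>A possibly time-inhomogeneous Markov chain \<open>(X t)\<close>, \<open>t \<ge> m\<close>, on a countable state space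
  \<open>S\<close>. As division by zero yields zero, \<^const>\<open>cond_prob\<close> is only used here for conditioning
  events of positive probability.\<close>

definition markov_chain_from :: "'a measure \<Rightarrow> 'b set \<Rightarrow> nat \<Rightarrow> (nat \<Rightarrow> 'a \<Rightarrow> 'b) \<Rightarrow> bool" where
  "markov_chain_from M S m X \<longleftrightarrow>
     countable S \<and>
     (\<forall>t\<ge>m. X t \<in> measurable M (count_space S)) \<and>
     (\<forall>t\<ge>m. \<forall>s \<in> {m..Suc t} \<rightarrow> S.
        \<P>(\<omega> in M. \<forall>i\<in>{m..t}. X i \<omega> = s i) > 0 \<longrightarrow>
        \<P>(\<omega> in M. X (Suc t) \<omega> = s (Suc t) \<bar> \<forall>i\<in>{m..t}. X i \<omega> = s i) =
        \<P>(\<omega> in M. X (Suc t) \<omega> = s (Suc t) \<bar> X t \<omega> = s t))"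

end

theory Submission
  imports Defs
begin

text \<open>
  The symbol \<open>\<infinity>\<close> never influences the other entries during Schensted insertion: it is moved to
  the row above exactly when the regular part acquires a box at its position. Hence the
  augmented process is a deterministic function of the path of regular parts
  \<open>\<lambda>\<^sup>(\<^sup>m\<^sup>), \<dots>, \<lambda>\<^sup>(\<^sup>t\<^sup>)\<close>, and it suffices that the Plancherel growth process, conditioned on
  its whole history, moves from \<open>\<lambda>\<close> with probabilities that depend on \<open>\<lambda>\<close> only.

  By the Robinson--Schensted correspondence, the words with a given multiset of letters and a
  given path of shapes are in bijection with the tableaux of the final shape and the given
  content, so their number depends on the path through its endpoint only. Summing over all
  permutations of the sample and using exchangeability, the probability of a path is therefore
  a function of its endpoint, which gives the Markov property.
\<close>

subsection \<open>Insertion into tableaux\<close>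

text \<open>Pins down the bumping position by its defining inequalities, so that it can be found in
  a sorted row and prescribed in reverse bumping.\<close>

lemma row_insertI:
  assumes "j \<le> length r" "\<And>p. p < j \<Longrightarrow> r ! p \<le> a" "j < length r \<Longrightarrow> a < r ! j"
  shows "row_insert r a = (if j < length r then (r[j := a], Some (r ! j)) else (r @ [a], None))"
  using assms
proof (induction r arbitrary: j)
  case (Cons x xs)
  show ?case
  proof (cases j)
    case 0
    then show ?thesis using Cons.prems by simp
  next
    case (Suc i)
    have "x \<le> a" using Cons.prems(2)[of 0] Suc by simp
    moreover have "row_insert xs a =
        (if i < length xs then (xs[i := a], Some (xs ! i)) else (xs @ [a], None))"
      using Cons.prems(1,3) Cons.prems(2)[of "Suc _"] Suc by (intro Cons.IH) auto
    ultimately show ?thesis using Suc by auto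
  qed
qed simp

lemma row_insertE:
  assumes "sorted r"
  obtains j where "j \<le> length r" "\<And>p. p < j \<Longrightarrow> r ! p \<le> a"
    "\<And>p. j \<le> p \<Longrightarrow> p < length r \<Longrightarrow> a < r ! p"
    "row_insert r a = (if j < length r then (r[j := a], Some (r ! j)) else (r @ [a], None))"
proof -
  define j where "j = length (takeWhile (\<lambda>x. x \<le> a) r)"
  have 1: "j \<le> length r" by (simp add: j_def length_takeWhile_le)
  have 2: "r ! p \<le> a" if "p < j" for p
    using that nth_mem[of p "takeWhile (\<lambda>x. x \<le> a) r"] set_takeWhileD
    unfolding j_def by (fastforce simp: takeWhile_nth)
  have 3: "a < r ! j" if "j < length r"
    using that nth_length_takeWhile[of "\<lambda>x. x \<le> a" r] by (simp add: j_def not_le)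
  have 4: "a < r ! p" if "j \<le> p" "p < length r" for p
    using 3 that sorted_nth_mono[OF assms that] by auto
  show ?thesis using that[OF 1 2 4 row_insertI[OF 1 2 3]] by blast
qed

lemma mset_row_insert:
  "mset (fst (row_insert r a)) + (case snd (row_insert r a) of None \<Rightarrow> {#} | Some b \<Rightarrow> {#b#})
     = add_mset a (mset r)"
  by (induction r) (auto split: prod.splits option.splits)

lemma mset_schensted_insert: "mset (concat (schensted_insert T a)) = add_mset a (mset (concat T))"
proof (induction T arbitrary: a)
  case (Cons r rs)
  then show ?case
    using mset_row_insert[of r a]
    by (auto split: prod.splits option.splits simp: union_ac)
qed simp

lemma P_tableau_snoc [simp]: "P_tableau (w @ [a]) = schensted_insert (P_tableau w) a"
  and P_tableau_Nil [simp]: "P_tableau [] = []"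
  by (simp_all add: P_tableau_def)

lemma mset_P_tableau: "mset (concat (P_tableau w)) = mset w"
  by (induction w rule: rev_induct) (simp_all add: mset_schensted_insert del: mset_concat)

lemma set_P_tableau: "set (concat (P_tableau w)) = set w"
  using mset_P_tableau mset_eq_setD by blast

section \<open>The box gained in an insertion step\<close>

fun new_row :: "'a::linorder list list \<Rightarrow> 'a \<Rightarrow> nat" where
  "new_row [] a = 0"
| "new_row (r # rs) a =
     (case snd (row_insert r a) of None \<Rightarrow> 0 | Some b \<Rightarrow> Suc (new_row rs b))"

text \<open>Rows above the top one get length \<open>0\<close>, so shapes can be compared row by row
  without knowing the number of rows.\<close>

definition row_length :: "'a list list \<Rightarrow> nat \<Rightarrow> nat" where
  "row_length T y = (if y < length T then length (T ! y) else 0)"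

lemma row_length_Nil [simp]: "row_length [] y = 0"
  and row_length_Cons_0 [simp]: "row_length (r # rs) 0 = length r"
  and row_length_Cons_Suc [simp]: "row_length (r # rs) (Suc y) = row_length rs y"
  by (simp_all add: row_length_def)

lemma length_row_insert:
  "length (fst (row_insert r a)) =
     (case snd (row_insert r a) of None \<Rightarrow> Suc (length r) | Some b \<Rightarrow> length r)"
  by (induction r) (auto split: prod.splits option.splits)

lemma row_length_schensted_insert:
  "row_length (schensted_insert T a) y =
     (if y = new_row T a then Suc (row_length T y) else row_length T y)"
proof (induction T arbitrary: a y)
  case Nil
  then show ?case by (cases y) auto
next
  case (Cons r rs)
  then show ?case
    using length_row_insert[of r a]
    by (cases y) (auto split: prod.splits option.splits)
qed

section \<open>Semistandard tableaux and their preservation under insertion\<close>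

definition column_strict :: "'a::linorder list \<Rightarrow> 'a list \<Rightarrow> bool" where
  "column_strict r s \<longleftrightarrow> length s \<le> length r \<and> (\<forall>p<length s. r ! p < s ! p)"

text \<open>Semistandard tableaux in French convention: in \<open>column_strict r s\<close> the row
  \<open>r\<close> lies directly below \<open>s\<close>. Equal entries within a row are allowed
  because words may repeat letters; nonempty rows let the shape determine the number of
  rows.\<close>

definition tableau :: "'a::linorder list list \<Rightarrow> bool" where
  "tableau T \<longleftrightarrow> (\<forall>r\<in>set T. r \<noteq> [] \<and> sorted r) \<and> successively column_strict T"

lemma tableau_Nil [simp]: "tableau []"
  by (simp add: tableau_def)

lemma tableau_Cons:
  "tableau (r # rs) \<longleftrightarrow>
     r \<noteq> [] \<and> sorted r \<and> (rs = [] \<or> column_strict r (hd rs)) \<and> tableau rs"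
  by (auto simp: tableau_def successively_Cons)

lemma hd_schensted_insert:
  "hd (schensted_insert T a) = fst (row_insert (case T of [] \<Rightarrow> [] | r # _ \<Rightarrow> r) a)"
  by (cases T) (auto split: prod.splits option.splits)

lemma sorted_list_update_between:
  assumes "sorted r" "j < length r" "\<And>p. p < j \<Longrightarrow> r ! p \<le> a"
    "\<And>p. j < p \<Longrightarrow> p < length r \<Longrightarrow> a \<le> r ! p"
  shows "sorted (r[j := a])"
  unfolding sorted_iff_nth_mono_less
  using assms sorted_nth_mono[OF assms(1)] by (auto simp: nth_list_update)

text \<open>The bumping route drifts weakly to the left as it climbs (\<open>j \<le> i\<close>),
  because the entry above the bumped one was larger than it. So the bumped entry lands above an
  entry that is at most \<open>a\<close>, hence smaller.\<close>

lemma tableau_schensted_insert: "tableau T \<Longrightarrow> tableau (schensted_insert T a)"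
proof (induction T arbitrary: a)
  case Nil
  then show ?case by (simp add: tableau_Cons)
next
  case (Cons r rs)
  have r: "r \<noteq> []" "sorted r" and rs: "tableau rs" and
    cs: "rs \<noteq> [] \<Longrightarrow> column_strict r (hd rs)"
    using Cons.prems by (auto simp: tableau_Cons)
  obtain i where i: "i \<le> length r" "\<And>p. p < i \<Longrightarrow> r ! p \<le> a"
    "\<And>p. i \<le> p \<Longrightarrow> p < length r \<Longrightarrow> a < r ! p"
    "row_insert r a = (if i < length r then (r[i := a], Some (r ! i)) else (r @ [a], None))"
    using row_insertE[OF r(2), of a] by metis
  show ?case
  proof (cases "i < length r")
    case False
    then have "i = length r" using i(1) by simp
    then have "sorted (r @ [a])"
      using i(2) r(2) by (auto simp: sorted_append in_set_conv_nth)
    moreover have "rs \<noteq> [] \<Longrightarrow> column_strict (r @ [a]) (hd rs)"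
      using cs by (auto simp: column_strict_def nth_append)
    ultimately show ?thesis using False i(4) rs by (auto simp: tableau_Cons)
  next
    case True
    define x where "x = r ! i"
    \<comment> \<open>An empty row stands for a missing one, so that bumping into a row and opening
      a new row are treated alike.\<close>
    define s where "s = (case rs of [] \<Rightarrow> [] | s # _ \<Rightarrow> s)"
    have s: "sorted s" using rs by (auto simp: s_def tableau_Cons split: list.split)
    have rs_col: "length s \<le> length r" "\<And>p. p < length s \<Longrightarrow> r ! p < s ! p"
      using cs by (auto simp: s_def column_strict_def split: list.splits)
    obtain j where j: "j \<le> length s" "\<And>p. p < j \<Longrightarrow> s ! p \<le> x"
      "row_insert s x = (if j < length s then (s[j := x], Some (s ! j)) else (s @ [x], None))"
      using row_insertE[OF s, of x] by metis
    have ji: "j \<le> i"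
    proof (rule ccontr)
      assume "\<not> j \<le> i"
      then have "i < j" "i < length s" using j(1) by auto
      then show False using j(2)[of i] rs_col(2)[of i] by (simp add: x_def)
    qed
    have ax: "a < x" using i(3)[of i] True by (simp add: x_def)
    have jx: "r[i := a] ! j < x"
      using ji i(2)[of j] ax True by (cases "j = i") (auto simp: nth_list_update)
    \<comment> \<open>Below the other entries of \<open>s\<close>, exchanging \<open>x\<close> for
      the smaller \<open>a\<close> can only help.\<close>
    have dec: "r[i := a] ! p < s ! p" if "p < length s" for p
      using that rs_col(2)[OF that] ax True by (cases "p = i") (auto simp: x_def)
    have "column_strict (r[i := a]) (fst (row_insert s x))"
      using j(1,3) jx dec ji True rs_col(1)
      by (auto simp: column_strict_def nth_list_update nth_append less_Suc_eq)
    then have "column_strict (r[i := a]) (hd (schensted_insert rs x))"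
      by (simp add: hd_schensted_insert s_def)
    moreover have "sorted (r[i := a])"
      using i r True by (intro sorted_list_update_between) (auto intro: less_imp_le)
    ultimately show ?thesis
      using True i(4) r Cons.IH[OF rs] by (simp add: tableau_Cons x_def)
  qed
qed

lemma tableau_P_tableau: "tableau (P_tableau w)"
  by (induction w rule: rev_induct) (simp_all add: tableau_schensted_insert)

text \<open>Knowing the shape before insertion tells where the route ended, and the route is undone
  from the top: the induction hypothesis recovers the rows above and the bumped entry, whose place
  in the current row is forced by sortedness.\<close>

lemma schensted_insert_inj:
  assumes "\<forall>r\<in>set T. sorted r" "\<forall>r\<in>set T'. sorted r" "map length T = map length T'"
    "schensted_insert T a = schensted_insert T' a'"
  shows "T = T' \<and> a = a'"
  using assms
proof (induction T arbitrary: T' a a')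
  case (Cons r rs)
  then obtain r' rs' where T': "T' = r' # rs'" by (cases T') auto
  have len: "length r = length r'" "map length rs = map length rs'"
    using Cons.prems T' by auto
  have sr: "sorted r" "sorted r'" using Cons.prems T' by auto
  obtain i where i: "i \<le> length r" "\<And>p. p < i \<Longrightarrow> r ! p \<le> a"
    "\<And>p. i \<le> p \<Longrightarrow> p < length r \<Longrightarrow> a < r ! p"
    "row_insert r a = (if i < length r then (r[i := a], Some (r ! i)) else (r @ [a], None))"
    using row_insertE[OF sr(1), of a] by metis
  obtain j where j: "j \<le> length r'" "\<And>p. p < j \<Longrightarrow> r' ! p \<le> a'"
    "\<And>p. j \<le> p \<Longrightarrow> p < length r' \<Longrightarrow> a' < r' ! p"
    "row_insert r' a' = (if j < length r' then (r'[j := a'], Some (r' ! j)) else (r' @ [a'], None))"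
    using row_insertE[OF sr(2), of a'] by metis
  consider "i < length r" "j < length r'" | "\<not> i < length r" "\<not> j < length r'"
    | "i < length r" "\<not> j < length r'" | "\<not> i < length r" "j < length r'" by blast
  then show ?case
  proof cases
    case 1
    have eq: "r[i := a] = r'[j := a']"
      and eq': "schensted_insert rs (r ! i) = schensted_insert rs' (r' ! j)"
      using 1 Cons.prems(4) i(4) j(4) T' by auto
    have IH: "rs = rs'" "r ! i = r' ! j"
      using Cons.IH[OF _ _ len(2) eq'] Cons.prems T' by auto
    \<comment> \<open>Otherwise \<open>r'\<close> would contain at position \<open>i\<close> the
      letter \<open>a\<close>, to the right of the larger letter
      \<open>r' ! j = r ! i\<close>.\<close>
    have "\<not> j < i"
    proof
      assume "j < i"
      then have "r' ! i = a" using eq 1 by (metis len(1) nth_list_update_eq nth_list_update_neq less_irrefl)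
      moreover have "r' ! j \<le> r' ! i" using sorted_nth_mono[OF sr(2)] \<open>j < i\<close> 1 len by simp
      ultimately show False using IH(2) i(3)[of i] 1 by simp
    qed
    moreover have "\<not> i < j"
    proof
      assume "i < j"
      then have "r ! j = a'" using eq 1 by (metis len(1) nth_list_update_eq nth_list_update_neq less_irrefl)
      moreover have "r ! i \<le> r ! j" using sorted_nth_mono[OF sr(1)] \<open>i < j\<close> 1 len by simp
      ultimately show False using IH(2) j(3)[of j] 1 by simp
    qed
    ultimately have ij: "i = j" by simp
    have "a = a'" using eq ij 1 by (metis nth_list_update_eq)
    moreover have "r = r'"
      using eq ij IH(2) by (metis list_update_id list_update_overwrite)
    ultimately show ?thesis using IH T' by simp
  next
    case 2
    then show ?thesis using Cons.prems(4) i(4) j(4) T' by auto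
  next
    \<comment> \<open>In the two mixed cases exactly one of the first rows grows, although they
      started with equal lengths.\<close>
    case 3
    then show ?thesis using Cons.prems(4) i(4) j(4) T' len by (auto dest: arg_cong[of _ _ length])
  next
    case 4
    then show ?thesis using Cons.prems(4) i(4) j(4) T' len by (auto dest: arg_cong[of _ _ length])
  qed
qed auto

text \<open>Reverse bumping: the entry \<open>b\<close> ejected from the rows above replaces the rightmost entry
  smaller than \<open>b\<close>.\<close>

lemma schensted_insert_surj:
  assumes "tableau T'" "row_length T' (Suc k) < row_length T' k"
  obtains T a where "tableau T" "schensted_insert T a = T'" "new_row T a = k"
  using assms
proof (induction k arbitrary: T' thesis)
  case 0
  then obtain r' rs where T': "T' = r' # rs" by (cases T') auto
  have r': "r' \<noteq> []" "sorted r'" "tableau rs" "rs \<noteq> [] \<Longrightarrow> column_strict r' (hd rs)"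
    using 0 T' by (auto simp: tableau_Cons)
  obtain r a where r: "r' = r @ [a]" using r'(1) rev_exhaust by blast
  have ins: "row_insert r a = (r @ [a], None)"
    using row_insertI[of "length r" r a] r'(2) r by (auto simp: sorted_append)
  \<comment> \<open>Nothing lies above the last box of row \<open>0\<close>, since row
    \<open>1\<close> is strictly shorter; its entry \<open>a\<close> can be removed.\<close>
  have len: "row_length rs 0 \<le> length r" using 0(3) T' r by simp
  show ?case
  proof (cases "r = []")
    case True
    then have "rs = []" using len r'(3) by (cases rs) (auto simp: tableau_Cons)
    then show ?thesis using 0(1)[of "[]" a] T' r True by simp
  next
    case False
    have "rs \<noteq> [] \<Longrightarrow> column_strict r (hd rs)"
      using r'(4) len r by (cases rs) (auto simp: column_strict_def nth_append split: if_splits)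
    then have "tableau (r # rs)" using False r' r by (auto simp: tableau_Cons sorted_append)
    then show ?thesis using 0(1)[of "r # rs" a] ins T' r by simp
  qed
next
  case (Suc k)
  obtain r' rs' where T': "T' = r' # rs'" using Suc.prems(3) by (cases T') auto
  have len': "row_length rs' (Suc k) < row_length rs' k" using Suc.prems T' by simp
  then have "rs' \<noteq> []" by (cases rs') auto
  then have r': "r' \<noteq> []" "sorted r'" "tableau rs'" "column_strict r' (hd rs')"
    using Suc.prems T' by (auto simp: tableau_Cons)
  obtain rs b where rs: "tableau rs" "schensted_insert rs b = rs'" "new_row rs b = k"
    using Suc.IH[OF _ r'(3) len'] by metis
  define s where "s = (case rs of [] \<Rightarrow> [] | s # _ \<Rightarrow> s)"
  have s: "sorted s" using rs by (auto simp: s_def tableau_Cons split: list.split)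
  obtain j where j: "j \<le> length s" "\<And>p. p < j \<Longrightarrow> s ! p \<le> b"
    "\<And>p. j \<le> p \<Longrightarrow> p < length s \<Longrightarrow> b < s ! p"
    "row_insert s b = (if j < length s then (s[j := b], Some (s ! j)) else (s @ [b], None))"
    using row_insertE[OF s, of b] by metis
  have hd: "hd rs' = (if j < length s then s[j := b] else s @ [b])"
    using rs(2) hd_schensted_insert[of rs b] j(4) by (auto simp: s_def)
  have lens: "length s \<le> length r'" "j < length r'"
    using r'(4) hd j(1) by (auto simp: column_strict_def split: if_splits)
  have col: "r' ! p < s ! p" if "p < length s" "p \<noteq> j" for p
    using that r'(4) hd j(1)
    by (auto simp: column_strict_def nth_append split: if_splits dest!: spec[of _ p])
  \<comment> \<open>Above position \<open>j\<close> of \<open>r'\<close> the row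
    \<open>hd rs'\<close> carries \<open>b\<close>, so column strictness supplies an entry of
    \<open>r'\<close> smaller than \<open>b\<close>.\<close>
  have jb: "r' ! j < b"
    using r'(4) hd j(1) by (auto simp: column_strict_def nth_append split: if_splits dest!: spec[of _ j])
  \<comment> \<open>The rightmost such entry is at some \<open>i \<ge> j\<close>. From
    \<open>j\<close> on the entries of \<open>s\<close> exceed \<open>b\<close>, so \<open>b\<close>
    may be put at \<open>i\<close> without breaking a column.\<close>
  define I where "I = {p. p < length r' \<and> r' ! p < b}"
  define i where "i = Max I"
  have fin: "finite I" "j \<in> I" using jb lens by (auto simp: I_def)
  then have "i \<in> I" and ji: "j \<le> i" unfolding i_def by (auto intro: Max_in Max_ge)
  then have i: "i < length r'" "r' ! i < b" by (auto simp: I_def)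
  have igt: "b \<le> r' ! p" if "i < p" "p < length r'" for p
    using that Max_ge[OF fin(1), of p] unfolding i_def[symmetric] by (force simp: I_def)
  have ile: "r' ! p \<le> r' ! i" if "p < i" for p
    using sorted_nth_mono[OF r'(2), of p i] that i by simp
  define a where "a = r' ! i"
  define r where "r = r'[i := b]"
  have "sorted r" unfolding r_def
    using r'(2) i igt ile by (intro sorted_list_update_between) (auto intro: less_imp_le order.trans[OF ile])
  moreover have "column_strict r s"
    unfolding column_strict_def
  proof (intro conjI allI impI)
    fix p assume p: "p < length s"
    show "r ! p < s ! p"
    proof (cases "p = i")
      case True
      then show ?thesis using j(3)[of p] p ji i by (simp add: r_def)
    next
      case False
      have "r' ! p < s ! p"
      proof (cases "p = j")
        case True
        then show ?thesis using jb j(3)[of j] p by auto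
      qed (use col p in auto)
      then show ?thesis using False by (simp add: r_def)
    qed
  qed (use lens in \<open>simp add: r_def\<close>)
  then have "rs \<noteq> [] \<Longrightarrow> column_strict r (hd rs)" by (cases rs) (auto simp: s_def)
  ultimately have tab: "tableau (r # rs)" using rs(1) r'(1) by (auto simp: tableau_Cons r_def)
  have "row_insert r a = (if i < length r then (r[i := a], Some (r ! i)) else (r @ [a], None))"
    using i ile by (intro row_insertI) (auto simp: r_def a_def)
  then have "row_insert r a = (r', Some b)" using i by (simp add: r_def a_def)
  then show ?case using Suc.prems(1)[OF tab, of a] rs T' by simp
qed

subsection \<open>Shapes\<close>

lemma shape_eq: "shape T = {(x, y). x < row_length T y}"
  by (auto simp: shape_def row_length_def)

lemma finite_shape: "finite (shape T)"
proof -
  have "shape T \<subseteq> (\<Union>y<length T. {..<length (T ! y)} \<times> {y})"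
    by (auto simp: shape_def)
  then show ?thesis by (rule finite_subset) auto
qed

lemma row_length_antimono:
  assumes "tableau T" "y \<le> y'"
  shows "row_length T y' \<le> row_length T y"
proof -
  have "row_length T (Suc z) \<le> row_length T z" for z
    using assms(1)
  proof (induction T arbitrary: z)
    case (Cons r rs)
    show ?case
    proof (cases z)
      case 0
      then show ?thesis using Cons.prems by (cases rs) (auto simp: tableau_Cons column_strict_def)
    next
      case (Suc z')
      then show ?thesis using Cons.IH[of z'] Cons.prems by (simp add: tableau_Cons)
    qed
  qed simp
  then show ?thesis using assms(2) by (rule lift_Suc_antimono_le)
qed

lemma young_diagram_shape:
  assumes "tableau T"
  shows "young_diagram (shape T)"
  unfolding young_diagram_def
  using finite_shape row_length_antimono[OF assms] by (fastforce simp: shape_eq)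

lemma young_diagram_RSK: "young_diagram (RSK w)"
  unfolding RSK_def by (intro young_diagram_shape tableau_P_tableau)

lemma shape_schensted_insert:
  "shape (schensted_insert T a) = insert (row_length T (new_row T a), new_row T a) (shape T)"
  by (auto simp: shape_eq row_length_schensted_insert split: if_splits)

lemma young_edge_RSK_snoc: "young_edge (RSK w) (RSK (w @ [a]))"
proof -
  let ?k = "new_row (P_tableau w) a"
  let ?b = "(row_length (P_tableau w) ?k, ?k)"
  have "RSK (w @ [a]) = insert ?b (RSK w)"
    by (simp add: RSK_def shape_schensted_insert)
  moreover have "?b \<notin> RSK w" by (simp add: RSK_def shape_eq)
  ultimately show ?thesis unfolding young_edge_def by (metis young_diagram_RSK)
qed

text \<open>The box to be vacated is a corner, that is, the last box of a row strictly longer than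
  the next one; reverse bumping starts there and frees precisely this box.\<close>

lemma schensted_insert_surj_shape:
  assumes "tableau T'" "young_edge D (shape T')"
  obtains T a where "tableau T" "schensted_insert T a = T'" "shape T = D"
proof -
  obtain x k where D: "young_diagram D" "(x, k) \<notin> D" "shape T' = insert (x, k) D"
    using assms(2) by (auto simp: young_edge_def)
  have x: "x < row_length T' k" using D(3) by (auto simp: shape_eq)
  have down: "(x', y') \<in> D" if "(x'', y'') \<in> D" "x' \<le> x''" "y' \<le> y''" for x' y' x'' y''
    using D(1) that by (auto simp: young_diagram_def)
  have notin: "(x', y') \<notin> shape T'" if "x \<le> x'" "k \<le> y'" "(x', y') \<noteq> (x, k)" for x' y'
    using down[of x' y' x k] D(2,3) that by auto
  have "row_length T' (Suc k) \<le> x" using notin[of x "Suc k"] by (simp add: shape_eq)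
  then have lt: "row_length T' (Suc k) < row_length T' k" using x by simp
  have len: "row_length T' k = Suc x" using notin[of "Suc x" k] x by (simp add: shape_eq)
  obtain T a where T: "tableau T" "schensted_insert T a = T'" "new_row T a = k"
    using schensted_insert_surj[OF assms(1) lt] by blast
  have "row_length T k = x"
    using row_length_schensted_insert[of T a k] T len by simp
  then have "shape T' = insert (x, k) (shape T)" "(x, k) \<notin> shape T"
    using shape_schensted_insert[of T a] T by (auto simp: shape_eq)
  then have "shape T = D" using D by auto
  then show ?thesis using that T by blast
qed

text \<open>The shape determines the number of rows because rows of a tableau are nonempty.\<close>

lemma map_length_eq:
  fixes T T' :: "'a::linorder list list"
  assumes "tableau T" "tableau T'" "shape T = shape T'"
  shows "map length T = map length T'"
proof -
  have rl: "row_length T y = row_length T' y" for y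
  proof -
    have "x < row_length T y \<longleftrightarrow> x < row_length T' y" for x
      using assms(3) by (auto simp: shape_eq set_eq_iff)
    then show ?thesis by (meson linorder_neqE_nat less_irrefl)
  qed
  have pos: "0 < row_length U y \<longleftrightarrow> y < length U" if "tableau U" for y and U :: "'a list list"
    using that nth_mem[of y U] by (auto simp: row_length_def tableau_def)
  have "y < length T \<longleftrightarrow> y < length T'" for y
    using pos[OF assms(1), of y] pos[OF assms(2), of y] rl by simp
  then have "length T = length T'" by (meson linorder_neqE_nat less_irrefl)
  then show ?thesis
    using rl by (intro nth_equalityI) (auto simp: row_length_def, metis)
qed

lemma schensted_insert_inj_shape:
  assumes "tableau T" "tableau T'" "shape T = shape T'"
    "schensted_insert T a = schensted_insert T' a'"
  shows "T = T' \<and> a = a'"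
  using schensted_insert_inj[OF _ _ map_length_eq[OF assms(1-3)] assms(4)] assms(1,2)
  by (auto simp: tableau_def)

subsection \<open>Words with a given sequence of shapes\<close>

definition rsk_path :: "'a::linorder list \<Rightarrow> box set list" where
  "rsk_path w = map (\<lambda>i. RSK (take i w)) [0..<Suc (length w)]"

text \<open>These chains encode the standard Young tableaux with \<open>n\<close> boxes. Their
  length is \<open>Suc n\<close> as the empty diagram is listed.\<close>

definition young_paths :: "nat \<Rightarrow> box set list set" where
  "young_paths n = {\<gamma>. length \<gamma> = Suc n \<and> hd \<gamma> = {} \<and> successively young_edge \<gamma>}"

lemma RSK_Nil [simp]: "RSK [] = {}"
  by (simp add: RSK_def shape_def)

lemma rsk_path_Nil [simp]: "rsk_path [] = [{}]"
  by (simp add: rsk_path_def)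

lemma rsk_path_snoc [simp]: "rsk_path (w @ [a]) = rsk_path w @ [RSK (w @ [a])]"
  by (auto simp: rsk_path_def intro!: map_cong)

lemma length_rsk_path [simp]: "length (rsk_path w) = Suc (length w)"
  by (simp add: rsk_path_def)

lemma last_rsk_path [simp]: "last (rsk_path w) = RSK w"
  by (simp add: rsk_path_def)

lemma young_paths_0: "young_paths 0 = {[{}]}"
  by (auto simp: young_paths_def length_Suc_conv)

lemma young_paths_snoc:
  "\<gamma> @ [D] \<in> young_paths (Suc n) \<longleftrightarrow> \<gamma> \<in> young_paths n \<and> young_edge (last \<gamma>) D"
  by (cases "\<gamma> = []") (auto simp: young_paths_def successively_append_iff)

lemma rsk_path_in_young_paths: "rsk_path w \<in> young_paths (length w)"
  by (induction w rule: rev_induct)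
    (auto simp: young_paths_0 young_paths_snoc young_edge_RSK_snoc)

lemma young_paths_Suc:
  "young_paths (Suc n) = {\<gamma> @ [D] |\<gamma> D. \<gamma> \<in> young_paths n \<and> young_edge (last \<gamma>) D}"
proof -
  have "\<exists>\<gamma>' D. \<gamma> = \<gamma>' @ [D]" if "\<gamma> \<in> young_paths (Suc n)" for \<gamma>
    using that by (cases \<gamma> rule: rev_cases) (auto simp: young_paths_def)
  then show ?thesis using young_paths_snoc by blast
qed

text \<open>A new box other than \<open>(0, 0)\<close> is the right or upper neighbour of a box of
  \<open>D\<close>, which leaves finitely many candidates; an infinite \<open>D\<close> is no Young
  diagram and has no edges.\<close>

lemma finite_young_edge: "finite {D'. young_edge D D'}"
proof (cases "finite D")
  case True
  define B where "B = insert (0, 0) ((\<lambda>(x, y). (Suc x, y)) ` D \<union> (\<lambda>(x, y). (x, Suc y)) ` D)"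
  have "{D'. young_edge D D'} \<subseteq> (\<lambda>b. insert b D) ` B"
  proof (clarify)
    fix D' assume "young_edge D D'"
    then obtain x y where D': "young_diagram D'" "(x, y) \<notin> D" "D' = insert (x, y) D"
      by (auto simp: young_edge_def)
    have "(x, y) \<in> B"
    proof (cases x)
      case x: (Suc x')
      have "(x', y) \<in> D'" using D'(1,3) x unfolding young_diagram_def
        by (meson insertI1 le_SucI order_refl)
      then have "(x', y) \<in> D" using D' x by simp
      then show ?thesis using x by (force simp: B_def)
    next
      case x: 0
      show ?thesis
      proof (cases y)
        case y: (Suc y')
        have "(x, y') \<in> D'" using D'(1,3) y unfolding young_diagram_def
          by (meson insertI1 le_SucI order_refl)
        then have "(x, y') \<in> D" using D' y by simp
        then show ?thesis using y by (force simp: B_def)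
      qed (use x in \<open>simp add: B_def\<close>)
    qed
    then show "D' \<in> (\<lambda>b. insert b D) ` B" using D' by blast
  qed
  moreover have "finite B" using True by (simp add: B_def)
  ultimately show ?thesis by (meson finite_surj)
next
  case False
  then show ?thesis by (simp add: young_edge_def young_diagram_def)
qed

lemma finite_young_paths: "finite (young_paths n)"
proof (induction n)
  case (Suc n)
  have "young_paths (Suc n) = (\<Union>\<gamma>\<in>young_paths n. (\<lambda>D. \<gamma> @ [D]) ` {D. young_edge (last \<gamma>) D})"
    by (auto simp: young_paths_Suc)
  then show ?case using Suc finite_young_edge by auto
qed (simp add: young_paths_0)

definition words_along :: "'a::linorder multiset \<Rightarrow> box set list \<Rightarrow> 'a list set" where
  "words_along A \<gamma> = {w. mset w = A \<and> rsk_path w = \<gamma>}"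

text \<open>Semistandard tableaux of shape \<open>D\<close> and content \<open>A\<close>, counted by
  a Kostka number.\<close>

definition tableaux_of :: "'a::linorder multiset \<Rightarrow> box set \<Rightarrow> 'a list list set" where
  "tableaux_of A D = {T. tableau T \<and> mset (concat T) = A \<and> shape T = D}"

lemma tableau_eq_Nil_iff: "tableau T \<Longrightarrow> shape T = {} \<longleftrightarrow> T = []"
  by (cases T) (auto simp: tableau_Cons shape_eq intro!: exI[of _ 0])

text \<open>The Robinson--Schensted correspondence, with the path of shapes as recording tableau.\<close>

theorem bij_betw_P_tableau:
  assumes "\<gamma> \<in> young_paths n"
  shows "bij_betw P_tableau (words_along A \<gamma>) (tableaux_of A (last \<gamma>))"
  using assms
proof (induction n arbitrary: A \<gamma>)
  case 0
  have "w = []" if "rsk_path w = [{}]" for w :: "'a list"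
    using arg_cong[OF that, of length] by simp
  then have "words_along A \<gamma> = (if A = {#} then {[]} else {})"
    using 0 by (auto simp: young_paths_0 words_along_def)
  moreover have "tableaux_of A (last \<gamma>) = (if A = {#} then {[]} else {})"
    using 0 by (auto simp: young_paths_0 tableaux_of_def tableau_eq_Nil_iff simp del: mset_concat)
       (auto simp: shape_def)
  ultimately show ?case by (auto simp: bij_betw_def)
next
  case (Suc n)
  then obtain \<gamma>' D where \<gamma>: "\<gamma> = \<gamma>' @ [D]" "\<gamma>' \<in> young_paths n" "young_edge (last \<gamma>') D"
    by (auto simp: young_paths_Suc)
  have snoc: "\<exists>v a. w = v @ [a] \<and> v \<in> words_along (A - {#a#}) \<gamma>' \<and> RSK w = D"
    if "w \<in> words_along A \<gamma>" for w
  proof -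
    have "rsk_path w = \<gamma>" "mset w = A" using that by (auto simp: words_along_def)
    moreover from this have "w \<noteq> []" using \<gamma> by (auto simp: young_paths_def)
    then obtain v a where "w = v @ [a]" using rev_exhaust by blast
    ultimately show ?thesis using \<gamma> by (auto simp: words_along_def)
  qed
  show ?case
    unfolding bij_betw_def
  proof (intro conjI inj_onI equalityI subsetI)
    fix w w' assume w: "w \<in> words_along A \<gamma>" "w' \<in> words_along A \<gamma>" "P_tableau w = P_tableau w'"
    obtain v a where v: "w = v @ [a]" "v \<in> words_along (A - {#a#}) \<gamma>'" using snoc w by blast
    obtain v' a' where v': "w' = v' @ [a']" "v' \<in> words_along (A - {#a'#}) \<gamma>'" using snoc w by blast
    \<comment> \<open>Both prefixes follow \<open>\<gamma>'\<close>, so their insertion tableaux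
      have the same shape and the last insertion can be undone uniquely.\<close>
    have "RSK v = RSK v'"
      using v v' last_rsk_path[of v] last_rsk_path[of v'] by (simp add: words_along_def)
    then have "P_tableau v = P_tableau v' \<and> a = a'"
      using w(3) v v' by (intro schensted_insert_inj_shape tableau_P_tableau) (auto simp: RSK_def)
    then show "w = w'"
      using v v' Suc.IH[OF \<gamma>(2), of "A - {#a#}"] by (auto simp: bij_betw_def inj_on_def)
  next
    fix T assume "T \<in> P_tableau ` words_along A \<gamma>"
    then show "T \<in> tableaux_of A (last \<gamma>)"
      using \<gamma> by (auto simp: words_along_def tableaux_of_def tableau_P_tableau mset_P_tableau
          RSK_def[symmetric] simp del: mset_concat simp flip: last_rsk_path)
  next
    fix T assume "T \<in> tableaux_of A (last \<gamma>)"
    then have T: "tableau T" "mset (concat T) = A" "shape T = D"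
      using \<gamma> by (auto simp: tableaux_of_def)
    \<comment> \<open>The last edge of the path prescribes the box to vacate; reverse bumping then
      produces the last letter \<open>a\<close>.\<close>
    obtain U a where U: "tableau U" "schensted_insert U a = T" "shape U = last \<gamma>'"
      using schensted_insert_surj_shape[OF T(1)] \<gamma>(3) T(3) by metis
    have A: "A = add_mset a (mset (concat U))" using T(2) U(2) mset_schensted_insert by metis
    then have "U \<in> tableaux_of (A - {#a#}) (last \<gamma>')"
      using U by (simp add: tableaux_of_def)
    then obtain v where v: "v \<in> words_along (A - {#a#}) \<gamma>'" "U = P_tableau v"
      using Suc.IH[OF \<gamma>(2), of "A - {#a#}"] by (auto simp: bij_betw_def)
    have "P_tableau (v @ [a]) = T" using U v by simp
    moreover have "v @ [a] \<in> words_along A \<gamma>"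
      using v U T \<gamma> A by (auto simp: words_along_def RSK_def)
    ultimately show "T \<in> P_tableau ` words_along A \<gamma>" by blast
  qed
qed

text \<open>Both sets of words correspond to the same set of tableaux, which sees the path only
  through its last shape.\<close>

corollary bij_betw_words_along:
  assumes "\<gamma> \<in> young_paths n" "\<gamma>' \<in> young_paths n" "last \<gamma> = last \<gamma>'"
  obtains f where "bij_betw f (words_along A \<gamma>) (words_along A \<gamma>')"
proof -
  have "bij_betw P_tableau (words_along A \<gamma>) (tableaux_of A (last \<gamma>'))"
    using bij_betw_P_tableau[OF assms(1)] assms(3) by simp
  then show ?thesis
    using that bij_betw_trans bij_betw_inv_into[OF bij_betw_P_tableau[OF assms(2)]] by metis
qed

subsection \<open>Exchangeability\<close>

text \<open>The word may have repeated letters, so ties in the sample need no separate treatment.\<close>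

lemma card_permutations_to_word:
  assumes "mset u = mset w"
  shows "card {\<sigma>. \<sigma> permutes {..<length w} \<and> permute_list \<sigma> w = u}
    = card {\<sigma>. \<sigma> permutes {..<length w} \<and> permute_list \<sigma> w = w}"
proof -
  let ?S = "\<lambda>u. {\<sigma>. \<sigma> permutes {..<length w} \<and> permute_list \<sigma> w = u}"
  obtain \<tau> where \<tau>: "\<tau> permutes {..<length w}" "permute_list \<tau> w = u"
    using mset_eq_permutation[OF assms] by blast
  have inv: "inv \<tau> permutes {..<length w}" using \<tau>(1) by (rule permutes_inv)
  have "permute_list (inv \<tau>) u = w"
    using permute_list_compose[OF inv, of \<tau>] permutes_inv_o(1)[OF \<tau>(1)] \<tau>(2) by simp
  \<comment> \<open>The permutations producing \<open>u\<close> form a coset of the stabiliser of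
    \<open>w\<close>; composing with \<open>inv \<tau>\<close> shifts the one onto the
    other.\<close>
  then have "bij_betw (\<lambda>\<sigma>. \<sigma> \<circ> inv \<tau>) (?S u) (?S w)"
    using \<tau> inv permutes_inv_o[OF \<tau>(1)]
    by (intro bij_betw_byWitness[where f' = "\<lambda>\<sigma>. \<sigma> \<circ> \<tau>"])
      (auto simp: permute_list_compose comp_assoc intro: permutes_compose)
  then show ?thesis by (rule bij_betw_same_card)
qed

text \<open>The permutations are grouped by the word they produce. Each word along the path is
  produced equally often, so only the number of these words counts, and it is the same for both
  paths.\<close>

lemma card_permutations_along:
  assumes "\<gamma> \<in> young_paths n" "\<gamma>' \<in> young_paths n" "last \<gamma> = last \<gamma>'" "length w = n"
  shows "card {\<sigma>. \<sigma> permutes {..<n} \<and> rsk_path (permute_list \<sigma> w) = \<gamma>}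
    = card {\<sigma>. \<sigma> permutes {..<n} \<and> rsk_path (permute_list \<sigma> w) = \<gamma>'}"
proof -
  let ?S = "\<lambda>u. {\<sigma>. \<sigma> permutes {..<n} \<and> permute_list \<sigma> w = u}"
  have fin: "finite (?S u)" for u
    by (rule finite_subset[OF _ finite_permutations[of "{..<n}"]]) auto
  have count: "card {\<sigma>. \<sigma> permutes {..<n} \<and> rsk_path (permute_list \<sigma> w) = \<gamma>}
    = card (words_along (mset w) \<gamma>) * card (?S w)" for \<gamma>
  proof -
    have "finite (words_along (mset w) \<gamma>)"
      by (rule finite_subset[OF _ finite_permutations_of_multiset[of "mset w"]])
        (auto simp: words_along_def permutations_of_multiset_def)
    moreover have "{\<sigma>. \<sigma> permutes {..<n} \<and> rsk_path (permute_list \<sigma> w) = \<gamma>}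
        = (\<Union>u\<in>words_along (mset w) \<gamma>. ?S u)"
      using assms(4) by (auto simp: words_along_def)
    ultimately have "card {\<sigma>. \<sigma> permutes {..<n} \<and> rsk_path (permute_list \<sigma> w) = \<gamma>}
        = (\<Sum>u\<in>words_along (mset w) \<gamma>. card (?S u))"
      using fin by (auto intro!: card_UN_disjoint)
    also have "\<dots> = (\<Sum>u\<in>words_along (mset w) \<gamma>. card (?S w))"
      unfolding assms(4)[symmetric]
      by (intro sum.cong refl card_permutations_to_word) (simp add: words_along_def)
    finally show ?thesis by simp
  qed
  obtain f where "bij_betw f (words_along (mset w) \<gamma>) (words_along (mset w) \<gamma>')"
    using bij_betw_words_along[OF assms(1-3)] by blast
  then have "card (words_along (mset w) \<gamma>) = card (words_along (mset w) \<gamma>')"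
    by (rule bij_betw_same_card)
  then show ?thesis unfolding count by (rule arg_cong)
qed

section \<open>Insertion under order-preserving relabelling of the letters\<close>

lemma row_insert_map:
  assumes "strict_mono_on (insert a (set r)) f"
  shows "row_insert (map f r) (f a) =
    (map f (fst (row_insert r a)), map_option f (snd (row_insert r a)))"
  using assms
proof (induction r)
  case (Cons x xs)
  have "f a < f x \<longleftrightarrow> a < x" using Cons.prems by (simp add: strict_mono_on_less)
  moreover have "strict_mono_on (insert a (set xs)) f"
    using Cons.prems by (rule monotone_on_subset) auto
  ultimately show ?case using Cons.IH by (auto split: prod.splits)
qed simp

lemma set_row_insert:
  "set (fst (row_insert r a)) \<subseteq> insert a (set r)"
  "set_option (snd (row_insert r a)) \<subseteq> set r"
  by (induction r) (auto split: prod.splits)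

lemma schensted_insert_map:
  assumes "strict_mono_on (insert a (set (concat T))) f"
  shows "schensted_insert (map (map f) T) (f a) = map (map f) (schensted_insert T a) \<and>
    new_row (map (map f) T) (f a) = new_row T a"
  using assms
proof (induction T arbitrary: a)
  case (Cons r rs)
  have r: "row_insert (map f r) (f a) =
      (map f (fst (row_insert r a)), map_option f (snd (row_insert r a)))"
    by (intro row_insert_map monotone_on_subset[OF Cons.prems]) auto
  have rs: "strict_mono_on (insert b (set (concat rs))) f" if "snd (row_insert r a) = Some b" for b
    using set_row_insert(2)[of r a] that by (intro monotone_on_subset[OF Cons.prems]) auto
  show ?case using r Cons.IH[OF rs] by (auto split: prod.splits option.splits)
qed auto

text \<open>Insertion merely compares letters. Monotonicity is asked on the letters of
  \<open>w\<close> only, since the rank function that will serve as \<open>f\<close> is strict on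
  the sample but not on the whole line.\<close>

lemma P_tableau_map:
  assumes "strict_mono_on (set w) f"
  shows "P_tableau (map f w) = map (map f) (P_tableau w)"
  using assms
proof (induction w rule: rev_induct)
  case (snoc a w)
  have "P_tableau (map f w) = map (map f) (P_tableau w)"
    using snoc.prems by (intro snoc.IH) (auto intro: monotone_on_subset)
  then show ?case
    using schensted_insert_map[of a "P_tableau w" f] snoc.prems set_P_tableau[of w] by simp
qed simp

lemma shape_map [simp]: "shape (map (map f) T) = shape T"
  by (auto simp: shape_def)

lemma rsk_path_map:
  assumes "strict_mono_on (set w) f"
  shows "rsk_path (map f w) = rsk_path w"
proof -
  have "RSK (map f (take i w)) = RSK (take i w)" for i
    using P_tableau_map[OF monotone_on_subset[OF assms set_take_subset]] by (simp add: RSK_def)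
  then show ?thesis by (simp add: rsk_path_def take_map)
qed

lemma measurable_rsk_path:
  "(\<lambda>x. rsk_path (map x [0..<n])) \<in> measurable (PiM {..<n} (\<lambda>_. borel :: real measure)) (count_space UNIV)"
proof -
  \<comment> \<open>The path only depends on the list of ranks, which takes countably many values.\<close>
  define rank where "rank = (\<lambda>x i. card {j. j < n \<and> x j < (x i :: real)})"
  let ?P = "PiM {..<n} (\<lambda>_. borel :: real measure)"
  have rank: "(\<lambda>x. rank x i) \<in> measurable ?P (count_space UNIV)" if "i < n" for i
  proof -
    have "{x \<in> space ?P. x j < x i} \<in> sets ?P" if "j < n" for j
      using that \<open>i < n\<close> by (intro borel_measurable_less measurable_component_singleton) auto
    then have "{x \<in> space ?P. j \<in> {j. j < n \<and> x j < x i}} \<in> sets ?P" for j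
      by (cases "j < n") simp_all
    then show ?thesis unfolding rank_def by (rule measurable_card)
  qed
  have "(\<lambda>x. map (rank x) [0..<n]) \<in> measurable ?P (count_space UNIV)"
  proof (subst measurable_count_space_eq2_countable, safe)
    fix l :: "nat list"
    have "{x \<in> space ?P. \<forall>i\<in>{..<n}. rank x i = l ! i} \<in> sets ?P"
      using measurable_sets_Collect[OF rank, of _ "\<lambda>k. k = l ! _"]
      by (intro sets.sets_Collect_finite_All) auto
    moreover have "map (rank x) [0..<n] = l \<longleftrightarrow> length l = n \<and> (\<forall>i\<in>{..<n}. rank x i = l ! i)" for x
      unfolding list_eq_iff_nth_eq by auto
    then have "(\<lambda>x. map (rank x) [0..<n]) -` {l} \<inter> space ?P
        = (if length l = n then {x \<in> space ?P. \<forall>i\<in>{..<n}. rank x i = l ! i} else {})"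
      by auto
    ultimately show "(\<lambda>x. map (rank x) [0..<n]) -` {l} \<inter> space ?P \<in> sets ?P" by simp
  qed auto
  then have "(\<lambda>x. rsk_path (map (rank x) [0..<n])) \<in> measurable ?P (count_space UNIV)"
    by (rule measurable_compose) simp
  moreover have "rsk_path (map (rank x) [0..<n]) = rsk_path (map x [0..<n])" for x
  proof -
    let ?f = "\<lambda>y. card {j. j < n \<and> x j < y}"
    have "strict_mono_on (set (map x [0..<n])) ?f"
    proof (rule strict_mono_onI)
      fix y z assume "y \<in> set (map x [0..<n])" "z \<in> set (map x [0..<n])" "y < z"
      then obtain j where "j < n" "x j = y" by auto
      \<comment> \<open>The index \<open>j\<close> of the smaller value is counted for
        \<open>z\<close> but not for \<open>y\<close>, as the comparison is strict. Tied values
        share a rank.\<close>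
      then have "j \<in> {j. j < n \<and> x j < z} - {j. j < n \<and> x j < y}" using \<open>y < z\<close> by simp
      moreover have "{j. j < n \<and> x j < y} \<subseteq> {j. j < n \<and> x j < z}" using \<open>y < z\<close> by auto
      ultimately show "?f y < ?f z" by (intro psubset_card_mono) auto
    qed
    from rsk_path_map[OF this] show ?thesis by (simp add: rank_def comp_def)
  qed
  ultimately show ?thesis by simp
qed

section \<open>Probabilities of paths of shapes\<close>

context prob_space
begin

text \<open>The joint law is a power of one probability measure, and permuting coordinates preserves
  it.\<close>

lemma prob_permute_iid:
  fixes X :: "nat \<Rightarrow> 'a \<Rightarrow> real"
  assumes "indep_vars (\<lambda>_. borel) X {..<n}" "\<And>i. i < n \<Longrightarrow> distr M borel (X i) = U"
    "\<sigma> permutes {..<n}" "A \<in> sets (PiM {..<n} (\<lambda>_. borel))"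
  shows "prob {\<omega> \<in> space M. (\<lambda>i\<in>{..<n}. X (\<sigma> i) \<omega>) \<in> A}
    = prob {\<omega> \<in> space M. (\<lambda>i\<in>{..<n}. X i \<omega>) \<in> A}"
proof (cases "n = 0")
  case False
  let ?B = "PiM {..<n} (\<lambda>_. borel :: real measure)" and ?U = "PiM {..<n} (\<lambda>_. U)"
  have rv: "random_variable borel (X i)" if "i < n" for i
    using assms(1) that by (auto simp: indep_vars_def)
  have U: "prob_space U" "sets U = sets borel" "space U = UNIV"
    using assms(2)[of 0] False rv[of 0] by (auto intro!: prob_space_distr)
  have sets_U: "sets ?U = sets ?B" "space ?U = space ?B"
    using U by (auto intro!: sets_PiM_cong simp: space_PiM)
  have joint: "distr M ?B (\<lambda>\<omega>. \<lambda>i\<in>{..<n}. X i \<omega>) = ?U"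
  proof -
    have "distr M ?B (\<lambda>\<omega>. \<lambda>i\<in>{..<n}. X i \<omega>) = PiM {..<n} (\<lambda>i. distr M borel (X i))"
      using indep_vars_iff_distr_eq_PiM'[of "{..<n}" X "\<lambda>_. borel"] assms(1) rv False by auto
    also have "\<dots> = ?U" using assms(2) by (intro PiM_cong) auto
    finally show ?thesis .
  qed
  have prob_joint: "prob {\<omega> \<in> space M. (\<lambda>i\<in>{..<n}. X i \<omega>) \<in> S} = measure ?U S"
    if S: "S \<in> sets ?B" for S
  proof -
    have "measure ?U S = prob ((\<lambda>\<omega>. \<lambda>i\<in>{..<n}. X i \<omega>) -` S \<inter> space M)"
      unfolding joint[symmetric] using S rv by (intro measure_distr measurable_restrict) auto
    then show ?thesis by (simp add: vimage_def Int_def conj_commute)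
  qed
  have \<sigma>: "inj_on \<sigma> {..<n}" "\<sigma> \<in> {..<n} \<rightarrow> {..<n}"
    using assms(3) permutes_inj_on permutes_in_image[OF assms(3)] by auto
  let ?t = "\<lambda>x. \<lambda>i\<in>{..<n}. x (\<sigma> i)"
  have t: "?t \<in> measurable ?B ?B"
    using \<sigma>(2) by (intro measurable_restrict measurable_component_singleton) auto
  have distr_t: "distr ?U ?U ?t = ?U"
    using distr_PiM_reindex[of "{..<n}" "\<lambda>_. U" \<sigma> "{..<n}"] U(1) \<sigma> by simp
  have "?t -` A \<inter> space ?B \<in> sets ?B" using measurable_sets[OF t assms(4)] .
  then have "prob {\<omega> \<in> space M. (\<lambda>i\<in>{..<n}. X i \<omega>) \<in> ?t -` A \<inter> space ?B}
      = measure ?U (?t -` A \<inter> space ?B)" by (rule prob_joint)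
  also have "\<dots> = measure (distr ?U ?U ?t) A"
    using measure_distr[of ?t ?U ?U A] t assms(4) sets_U
    by (simp cong: measurable_cong_sets)
  also have "\<dots> = prob {\<omega> \<in> space M. (\<lambda>i\<in>{..<n}. X i \<omega>) \<in> A}"
    unfolding distr_t by (rule prob_joint[OF assms(4), symmetric])
  also have "{\<omega> \<in> space M. (\<lambda>i\<in>{..<n}. X i \<omega>) \<in> ?t -` A \<inter> space ?B}
      = {\<omega> \<in> space M. (\<lambda>i\<in>{..<n}. X (\<sigma> i) \<omega>) \<in> A}"
  proof -
    have "?t (\<lambda>i\<in>{..<n}. X i \<omega>) = (\<lambda>i\<in>{..<n}. X (\<sigma> i) \<omega>)" for \<omega>
      using \<sigma>(2) by (auto simp: fun_eq_iff)
    then show ?thesis by (auto simp: space_PiM)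
  qed
  finally show ?thesis .
next
  \<comment> \<open>Without variables nothing determines \<open>U\<close>; both sides then concern
    the same constant function \<open>undefined\<close>.\<close>
  case True
  have "(\<lambda>i\<in>{..<n}. Y i) = (\<lambda>_. undefined)" for Y :: "nat \<Rightarrow> real"
    unfolding True by (rule ext) simp
  then show ?thesis by metis
qed

text \<open>The sample is averaged over all permutations. Each permuted event has the probability of
  the original one, while pointwise the number of permutations leading along \<open>\<gamma>\<close>
  depends on its endpoint only.\<close>

lemma prob_rsk_path_eq:
  fixes X :: "nat \<Rightarrow> 'a \<Rightarrow> real"
  assumes "indep_vars (\<lambda>_. borel) X {..<n}" "\<And>i. i < n \<Longrightarrow> distr M borel (X i) = U"
    "\<gamma> \<in> young_paths n" "\<gamma>' \<in> young_paths n" "last \<gamma> = last \<gamma>'"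
  shows "prob {\<omega> \<in> space M. rsk_path (map (\<lambda>i. X i \<omega>) [0..<n]) = \<gamma>}
    = prob {\<omega> \<in> space M. rsk_path (map (\<lambda>i. X i \<omega>) [0..<n]) = \<gamma>'}"
proof -
  let ?\<Sigma> = "{\<sigma>. \<sigma> permutes {..<n}}"
  let ?w = "\<lambda>\<omega>. map (\<lambda>i. X i \<omega>) [0..<n]"
  let ?E = "\<lambda>\<gamma> \<sigma>. {\<omega> \<in> space M. rsk_path (permute_list \<sigma> (?w \<omega>)) = \<gamma>}"
  have fin: "finite ?\<Sigma>" by (rule finite_permutations) simp
  have rv: "random_variable borel (X i)" if "i < n" for i
    using assms(1) that by (auto simp: indep_vars_def)
  have E: "?E \<gamma> \<sigma> = {\<omega> \<in> space M. (\<lambda>i\<in>{..<n}. X (\<sigma> i) \<omega>)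
      \<in> {x \<in> space (PiM {..<n} (\<lambda>_. borel)). rsk_path (map x [0..<n]) = \<gamma>}}"
    if "\<sigma> \<in> ?\<Sigma>" for \<gamma> \<sigma>
  proof -
    have "permute_list \<sigma> (?w \<omega>) = map (\<lambda>i\<in>{..<n}. X (\<sigma> i) \<omega>) [0..<n]" for \<omega>
      using that permutes_in_image[of \<sigma> "{..<n}"] by (auto simp: permute_list_def)
    then show ?thesis by (auto simp: space_PiM)
  qed
  have sets: "{x \<in> space (PiM {..<n} (\<lambda>_. borel)). rsk_path (map x [0..<n]) = \<gamma>}
      \<in> sets (PiM {..<n} (\<lambda>_. borel :: real measure))" for \<gamma>
    using measurable_sets_Collect[OF measurable_rsk_path, of "\<lambda>\<gamma>'. \<gamma>' = \<gamma>"] by simp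
  have ev: "?E \<gamma> \<sigma> \<in> events" if "\<sigma> \<in> ?\<Sigma>" for \<gamma> \<sigma>
  proof -
    have "(\<lambda>\<omega>. \<lambda>i\<in>{..<n}. X (\<sigma> i) \<omega>) \<in> measurable M (PiM {..<n} (\<lambda>_. borel))"
      using rv that permutes_in_image[of \<sigma> "{..<n}"] by (intro measurable_restrict) auto
    from measurable_sets[OF this sets] show ?thesis
      unfolding E[OF that] by (simp add: vimage_def Int_def conj_commute)
  qed
  have "(\<Sum>\<sigma>\<in>?\<Sigma>. prob (?E \<gamma> \<sigma>)) = real (card ?\<Sigma>) * prob {\<omega> \<in> space M. rsk_path (?w \<omega>) = \<gamma>}" for \<gamma>
  proof -
    have "prob (?E \<gamma> \<sigma>) = prob (?E \<gamma> id)" if "\<sigma> \<in> ?\<Sigma>" for \<sigma>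
      using prob_permute_iid[OF assms(1,2) _ sets, of \<sigma>]
        prob_permute_iid[OF assms(1,2) _ sets, of id] that E[OF that] E[of id]
      by (simp add: permutes_id)
    then show ?thesis by simp
  qed
  moreover have "(\<Sum>\<sigma>\<in>?\<Sigma>. prob (?E \<gamma> \<sigma>)) = (\<Sum>\<sigma>\<in>?\<Sigma>. prob (?E \<gamma>' \<sigma>))"
  proof -
    \<comment> \<open>The sum of probabilities is the expected number of permutations that lead
      along \<open>\<gamma>\<close>; at every sample point this number is the same for
      \<open>\<gamma>'\<close>.\<close>
    have *: "(\<Sum>\<sigma>\<in>?\<Sigma>. prob (?E \<gamma> \<sigma>)) = (\<integral>\<omega>. real (card {\<sigma>. \<sigma> permutes {..<n} \<and>
        rsk_path (permute_list \<sigma> (?w \<omega>)) = \<gamma>}) \<partial>M)" for \<gamma>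
    proof -
      have "(\<Sum>\<sigma>\<in>?\<Sigma>. prob (?E \<gamma> \<sigma>)) = (\<Sum>\<sigma>\<in>?\<Sigma>. \<integral>\<omega>. indicator (?E \<gamma> \<sigma>) \<omega> \<partial>M)"
        using ev by (intro sum.cong) auto
      also have "\<dots> = (\<integral>\<omega>. (\<Sum>\<sigma>\<in>?\<Sigma>. indicator (?E \<gamma> \<sigma>) \<omega>) \<partial>M)"
        using ev by (intro Bochner_Integration.integral_sum[symmetric]) (auto simp: emeasure_eq_measure)
      also have "\<dots> = (\<integral>\<omega>. real (card {\<sigma>. \<sigma> permutes {..<n} \<and>
        rsk_path (permute_list \<sigma> (?w \<omega>)) = \<gamma>}) \<partial>M)"
      proof (intro Bochner_Integration.integral_cong refl)
        fix \<omega> assume "\<omega> \<in> space M"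
        then have "(\<Sum>\<sigma>\<in>?\<Sigma>. indicator (?E \<gamma> \<sigma>) \<omega> :: real)
            = (\<Sum>\<sigma>\<in>?\<Sigma>. if rsk_path (permute_list \<sigma> (?w \<omega>)) = \<gamma> then 1 else 0)"
          by (intro sum.cong) (auto simp: indicator_def)
        also have "\<dots> = real (card {\<sigma> \<in> ?\<Sigma>. rsk_path (permute_list \<sigma> (?w \<omega>)) = \<gamma>})"
          using fin by (simp add: sum.If_cases Int_def)
        finally show "(\<Sum>\<sigma>\<in>?\<Sigma>. indicator (?E \<gamma> \<sigma>) \<omega>) = real (card {\<sigma>. \<sigma> permutes {..<n} \<and>
          rsk_path (permute_list \<sigma> (?w \<omega>)) = \<gamma>})" by simp
      qed
      finally show ?thesis .
    qed
    show ?thesis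
      unfolding * by (intro Bochner_Integration.integral_cong refl arg_cong[of _ _ real]
          card_permutations_along[OF assms(3-5)]) simp
  qed
  moreover have "card ?\<Sigma> > 0" using fin permutes_id card_gt_0_iff by blast
  ultimately show ?thesis by simp
qed

end

subsection \<open>Tableaux with one maximal entry\<close>

text \<open>Appends \<open>c\<close> to row \<open>k\<close>, where \<open>k = length T\<close>
  opens a new row. Larger \<open>k\<close> would also end in the new top row, hence the bound on
  \<open>k\<close> in what follows.\<close>

fun mark :: "'a \<Rightarrow> nat \<Rightarrow> 'a list list \<Rightarrow> 'a list list" where
  "mark c k [] = [[c]]"
| "mark c 0 (r # rs) = (r @ [c]) # rs"
| "mark c (Suc k) (r # rs) = r # mark c k rs"

lemma row_insert_snoc_top:
  assumes "a < c"
  shows "row_insert (r @ [c]) a =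
    (case row_insert r a of (r', None) \<Rightarrow> (r', Some c) | (r', Some b) \<Rightarrow> (r' @ [c], Some b))"
  using assms by (induction r) (auto split: prod.splits option.splits)

lemma row_insert_top:
  assumes "\<forall>x\<in>set r. x < c"
  shows "row_insert r c = (r @ [c], None)"
  using assms by (induction r) auto

lemma schensted_insert_top:
  assumes "\<forall>x\<in>set (concat T). x < c"
  shows "schensted_insert T c = mark c 0 T"
  using assms by (cases T) (simp_all add: row_insert_top)

text \<open>If the route of \<open>a\<close> ends in row \<open>k\<close>, the new box is the one
  held by \<open>c\<close>, and \<open>c\<close>, being bigger than everything in the next row, is
  appended there. Otherwise the route leaves \<open>c\<close> in place.\<close>

lemma schensted_insert_mark:
  assumes "k \<le> length T" "\<forall>x\<in>insert a (set (concat T)). x < c"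
  shows "schensted_insert (mark c k T) a =
    mark c (if new_row T a = k then Suc k else k) (schensted_insert T a)"
  using assms
proof (induction c k T arbitrary: a rule: mark.induct)
  case (1 c k)
  then show ?case by simp
next
  case (2 c r rs)
  have "schensted_insert rs c = mark c 0 rs"
    using 2 by (intro schensted_insert_top) simp
  then show ?case
    using 2 by (simp add: row_insert_snoc_top split: prod.splits option.splits)
next
  case (3 c k r rs)
  have "b < c" if "snd (row_insert r a) = Some b" for b
    using 3(3) set_row_insert(2)[of r a] that by auto
  then have IH: "schensted_insert (mark c k rs) b =
      mark c (if new_row rs b = k then Suc k else k) (schensted_insert rs b)"
    if "snd (row_insert r a) = Some b" for b
    using that 3 by (intro 3(1)) auto
  show ?case using IH by (auto split: prod.splits option.splits)
qed

lemma shape_mark: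
  assumes "k \<le> length T"
  shows "shape (mark c k T) = insert (row_length T k, k) (shape T)"
proof -
  have "row_length (mark c k T) y = (if y = k then Suc (row_length T k) else row_length T y)" for y
    using assms
  proof (induction c k T arbitrary: y rule: mark.induct)
    case (1 c k y)
    then show ?case by (cases y) auto
  next
    case (2 c r rs y)
    then show ?case by (cases y) auto
  next
    case (3 c k r rs y)
    then show ?case by (cases y) auto
  qed
  then show ?thesis by (auto simp: shape_eq split: if_splits)
qed

lemma entry_mark:
  assumes "k \<le> length T" "b \<in> shape (mark c k T)"
  shows "entry (mark c k T) b = (if b = (row_length T k, k) then c else entry T b)"
proof -
  have "mark c k T ! y ! x = (if (x, y) = (row_length T k, k) then c else T ! y ! x)"
    if "(x, y) \<in> shape (mark c k T)" for x y
    using assms(1) that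
  proof (induction c k T arbitrary: y rule: mark.induct)
    case (1 c k y)
    then show ?case by (auto simp: shape_def)
  next
    case (2 c r rs y)
    then show ?case by (cases y) (auto simp: shape_def nth_append)
  next
    case (3 c k r rs y)
    then show ?case by (cases y) (auto simp: shape_def)
  qed
  then show ?thesis using assms(2) by (cases b) (auto simp: entry_def)
qed

lemma entry_in_set: "b \<in> shape T \<Longrightarrow> entry T b \<in> set (concat T)"
  by (auto simp: shape_def entry_def) (meson nth_mem)

text \<open>Since \<open>\<infinity>\<close> does not occur in \<open>T\<close>, the definite
  description in \<open>augmented_shape\<close> picks exactly the marked box.\<close>

lemma augmented_shape_mark:
  assumes "k \<le> length T" "\<infinity> \<notin> set (concat T)"
  shows "augmented_shape (mark \<infinity> k T) = (shape T, (row_length T k, k))"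
proof -
  let ?b = "(row_length T k, k)"
  have "(THE b. b \<in> shape (mark \<infinity> k T) \<and> entry (mark \<infinity> k T) b = \<infinity>) = ?b"
  proof (rule the_equality)
    show "?b \<in> shape (mark \<infinity> k T) \<and> entry (mark \<infinity> k T) ?b = \<infinity>"
      using assms(1) entry_mark[OF assms(1)] by (simp add: shape_mark)
  next
    fix b assume b: "b \<in> shape (mark \<infinity> k T) \<and> entry (mark \<infinity> k T) b = \<infinity>"
    show "b = ?b"
    proof (rule ccontr)
      assume "b \<noteq> ?b"
      then have "entry T b = \<infinity>" "b \<in> shape T"
        using b entry_mark[OF assms(1), of b "\<infinity>"] shape_mark[OF assms(1), of "\<infinity>"] by auto
      then show False using entry_in_set assms(2) by metis
    qed
  qed
  moreover have "?b \<notin> shape T" by (simp add: shape_eq)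
  ultimately show ?thesis using assms(1) by (simp add: augmented_shape_def shape_mark)
qed

section \<open>The position of infinity along a word\<close>

definition augmented_RSK :: "nat \<Rightarrow> real list \<Rightarrow> aug_diagram" where
  "augmented_RSK m w =
     augmented_shape (P_tableau (map ereal (take m w) @ [\<infinity>] @ map ereal (drop m w)))"

text \<open>Invariant of the growth after time \<open>m\<close>: the tableau with the marker is the
  regular one with \<open>\<infinity>\<close> at the end of row \<open>k\<close>, and this place is
  an outer corner. The second conjunct also bounds \<open>k\<close> by the number of rows.\<close>

definition mark_row :: "nat \<Rightarrow> real list \<Rightarrow> nat \<Rightarrow> bool" where
  "mark_row m w k \<longleftrightarrow>
     P_tableau (map ereal (take m w) @ [\<infinity>] @ map ereal (drop m w))
       = mark \<infinity> k (map (map ereal) (P_tableau w)) \<and>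
     (k = 0 \<or> row_length (P_tableau w) k < row_length (P_tableau w) (k - 1))"

lemma row_length_map [simp]: "row_length (map (map f) T) = row_length T"
  by (auto simp: row_length_def fun_eq_iff)

lemma P_tableau_ereal: "P_tableau (map ereal w) = map (map ereal) (P_tableau w)"
  by (rule P_tableau_map) (simp add: strict_mono_on_def)

lemma mark_row_le_length: "mark_row m w k \<Longrightarrow> k \<le> length (P_tableau w)"
  by (cases k) (auto simp: mark_row_def row_length_def split: if_splits)

lemma mark_row_length: "mark_row (length w) w 0"
proof -
  have "schensted_insert (P_tableau (map ereal w)) \<infinity> = mark \<infinity> 0 (P_tableau (map ereal w))"
    using set_P_tableau[of "map ereal w"] by (intro schensted_insert_top) auto
  then show ?thesis by (simp add: mark_row_def P_tableau_ereal)
qed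

lemma mark_row_snoc:
  assumes "mark_row m w k" "m \<le> length w"
  shows "mark_row m (w @ [a]) (if new_row (P_tableau w) a = k then Suc k else k)"
proof -
  define T where "T = P_tableau w"
  let ?T = "map (map ereal) T" and ?j = "new_row T a"
  let ?k = "if ?j = k then Suc k else k"
  have mono: "strict_mono_on A ereal" for A by (simp add: strict_mono_on_def)
  have ins: "schensted_insert ?T (ereal a) = map (map ereal) (schensted_insert T a)"
    "new_row ?T (ereal a) = ?j"
    using schensted_insert_map[OF mono] by blast+
  have "P_tableau (map ereal (take m (w @ [a])) @ [\<infinity>] @ map ereal (drop m (w @ [a])))
      = schensted_insert (P_tableau (map ereal (take m w) @ [\<infinity>] @ map ereal (drop m w))) (ereal a)"
    using assms(2) P_tableau_snoc[of "map ereal (take m w) @ [\<infinity>] @ map ereal (drop m w)"] by simp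
  also have "\<dots> = schensted_insert (mark \<infinity> k ?T) (ereal a)"
    using assms(1) by (simp add: mark_row_def T_def)
  also have "\<dots> = mark \<infinity> ?k (map (map ereal) (schensted_insert T a))"
    using mark_row_le_length[OF assms(1)] ins by (subst schensted_insert_mark) (auto simp: T_def)
  finally have eq: "P_tableau (map ereal (take m (w @ [a])) @ [\<infinity>] @ map ereal (drop m (w @ [a])))
      = mark \<infinity> ?k (map (map ereal) (P_tableau (w @ [a])))" by (simp add: T_def)
  have T: "tableau T" unfolding T_def by (rule tableau_P_tableau)
  \<comment> \<open>A row \<open>k\<close> that has just grown is strictly longer than row
    \<open>Suc k\<close>; if another row grows, row \<open>k\<close> stays and row
    \<open>k - 1\<close> can only become longer.\<close>
  have "?k = 0 \<or> row_length (schensted_insert T a) ?k < row_length (schensted_insert T a) (?k - 1)"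
  proof (cases "?j = k")
    case True
    then show ?thesis
      using row_length_antimono[OF T, of k "Suc k"] by (auto simp: row_length_schensted_insert)
  next
    case False
    then show ?thesis
      using assms(1) by (auto simp: mark_row_def T_def[symmetric] row_length_schensted_insert)
  qed
  then show ?thesis using eq unfolding mark_row_def T_def by simp
qed

lemma augmented_RSK_eq:
  assumes "mark_row m w k"
  shows "augmented_RSK m w = (RSK w, (row_length (P_tableau w) k, k))"
proof -
  have "\<infinity> \<notin> set (concat (map (map ereal) (P_tableau w)))" by auto
  then show ?thesis
    using augmented_shape_mark[of k "map (map ereal) (P_tableau w)"] mark_row_le_length[OF assms] assms
    by (simp add: augmented_RSK_def mark_row_def RSK_def)
qed

lemma mark_row_exists:
  assumes "m \<le> length w"
  obtains k where "mark_row m w k"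
proof -
  \<comment> \<open>The induction starts when the marker enters, after \<open>m\<close> letters, and
    runs over the later letters.\<close>
  have "\<exists>k. mark_row m (take m w @ v) k" for v
  proof (induction v rule: rev_induct)
    case Nil
    then show ?case using mark_row_length[of "take m w"] assms by auto
  next
    case (snoc a v)
    then show ?case using mark_row_snoc[of m "take m w @ v" _ a] assms by fastforce
  qed
  from this[of "drop m w"] show ?thesis using that by auto
qed

lemma outer_corner_shape:
  assumes "tableau T" "k = 0 \<or> row_length T k < row_length T (k - 1)"
  shows "outer_corner (shape T) (row_length T k, k)"
proof -
  have "young_diagram (insert (row_length T k, k) (shape T))"
    unfolding young_diagram_def
  proof (intro conjI allI impI)
    show "finite (insert (row_length T k, k) (shape T))" using finite_shape by simp
  next
    fix x y x' y'
    assume "(x, y) \<in> insert (row_length T k, k) (shape T)" and le: "x' \<le> x" "y' \<le> y"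
    then consider "x = row_length T k" "y = k" | "x < row_length T y" by (auto simp: shape_eq)
    then have "x' < row_length T y' \<or> x' = row_length T k \<and> y' = k"
    proof cases
      case 1
      show ?thesis
      proof (cases "y' = k")
        case False
        then have "row_length T k < row_length T (k - 1)" "y' \<le> k - 1" using assms(2) le(2) 1 by auto
        then show ?thesis using row_length_antimono[OF assms(1), of y' "k - 1"] le(1) 1 by simp
      qed (use 1 le in auto)
    next
      case 2
      then show ?thesis using row_length_antimono[OF assms(1) le(2)] le(1) by simp
    qed
    then show "(x', y') \<in> insert (row_length T k, k) (shape T)" by (auto simp: shape_eq)
  qed
  then show ?thesis by (simp add: outer_corner_def shape_eq)
qed

lemma augmented_RSK_in_augmented_diagrams:
  assumes "m \<le> length w"
  shows "augmented_RSK m w \<in> augmented_diagrams"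
proof -
  obtain k where k: "mark_row m w k" using mark_row_exists[OF assms] .
  then show ?thesis
    using outer_corner_shape[OF tableau_P_tableau, of k w] young_diagram_RSK[of w]
    by (simp add: augmented_RSK_eq[OF k] augmented_diagrams_def mark_row_def RSK_def)
qed

lemma fst_augmented_RSK: "m \<le> length w \<Longrightarrow> fst (augmented_RSK m w) = RSK w"
  using mark_row_exists augmented_RSK_eq by (metis fst_conv)

section \<open>The special box as a function of the regular shapes\<close>

definition diagram_row_length :: "box set \<Rightarrow> nat \<Rightarrow> nat" where
  "diagram_row_length D y = card {x. (x, y) \<in> D}"

text \<open>The successor of \<open>L\<close> forced by the new regular part \<open>D\<close>: a row
  has only one candidate for an outer corner, its first free box, whose column is the length of the
  row.\<close>

definition next_augmented :: "aug_diagram \<Rightarrow> box set \<Rightarrow> aug_diagram" where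
  "next_augmented L D =
     (D, if D - fst L = {snd L}
         then (diagram_row_length D (Suc (snd (snd L))), Suc (snd (snd L))) else snd L)"

lemma diagram_row_length_shape [simp]: "diagram_row_length (shape T) y = row_length T y"
  by (simp add: diagram_row_length_def shape_eq)

lemma augmented_RSK_length: "augmented_RSK (length w) w = (RSK w, (diagram_row_length (RSK w) 0, 0))"
  using augmented_RSK_eq[OF mark_row_length] by (simp add: RSK_def)

text \<open>A new letter acts on the augmented shape only through the regular shape it creates,
  which reduces the augmented chain to the regular one.\<close>

lemma augmented_RSK_snoc:
  assumes "m \<le> length w"
  shows "augmented_RSK m (w @ [a]) = next_augmented (augmented_RSK m w) (RSK (w @ [a]))"
proof -
  obtain k where k: "mark_row m w k" using mark_row_exists[OF assms] .
  let ?T = "P_tableau w"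
  let ?j = "new_row ?T a"
  have new: "RSK (w @ [a]) - RSK w = {(row_length ?T ?j, ?j)}"
    using shape_schensted_insert[of ?T a] by (auto simp: RSK_def) (auto simp: shape_eq)
  show ?thesis
    using augmented_RSK_eq[OF k] augmented_RSK_eq[OF mark_row_snoc[OF k assms], of a] new
    by (auto simp: next_augmented_def RSK_def row_length_schensted_insert)
qed

lemma outer_corner_eq:
  assumes "young_diagram D" "outer_corner D (x, y)"
  shows "x = diagram_row_length D y"
proof -
  have x: "(x, y) \<notin> D" and ins: "young_diagram (insert (x, y) D)"
    using assms(2) by (auto simp: outer_corner_def)
  have "(x', y) \<in> D \<longleftrightarrow> x' < x" for x'
  proof
    assume "(x', y) \<in> D"
    then show "x' < x" using assms(1) x unfolding young_diagram_def by (meson le_refl not_le_imp_less)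
  next
    assume "x' < x"
    then have "(x', y) \<in> insert (x, y) D" using ins unfolding young_diagram_def
      by (meson insertI1 le_refl less_imp_le)
    then show "(x', y) \<in> D" using \<open>x' < x\<close> by simp
  qed
  then show ?thesis by (simp add: diagram_row_length_def)
qed

text \<open>Lets edges be read as a deterministic update, since an outer corner is determined by its
  row.\<close>

lemma augmented_edge_iff:
  assumes "L \<in> augmented_diagrams" "L' \<in> augmented_diagrams"
  shows "augmented_edge L L' \<longleftrightarrow> young_edge (fst L) (fst L') \<and> L' = next_augmented L (fst L')"
proof -
  have L': "young_diagram (fst L')" "outer_corner (fst L') (snd L')"
    using assms(2) by (auto simp: augmented_diagrams_def)
  have "fst (snd L') = diagram_row_length (fst L') (snd (snd L'))"
    using outer_corner_eq[OF L'(1), of "fst (snd L')" "snd (snd L')"] L'(2) by simp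
  then show ?thesis
    using assms L'(2)
    by (cases L'; cases "snd L'") (auto simp: augmented_edge_def next_augmented_def)
qed

lemma augmented_edge_RSK_snoc:
  assumes "m \<le> length w"
  shows "augmented_edge (augmented_RSK m w) (augmented_RSK m (w @ [a]))"
proof -
  have "augmented_RSK m w \<in> augmented_diagrams" "augmented_RSK m (w @ [a]) \<in> augmented_diagrams"
    using assms augmented_RSK_in_augmented_diagrams[of m] by auto
  then show ?thesis
    using assms young_edge_RSK_snoc augmented_RSK_snoc[OF assms, of a]
      fst_augmented_RSK[of m w] fst_augmented_RSK[of m "w @ [a]"]
    by (simp add: augmented_edge_iff)
qed

text \<open>\<open>G\<close> arises by iterating \<open>next_augmented\<close> along the shapes from
  time \<open>m\<close> on.\<close>

lemma augmented_RSK_rsk_path: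
  obtains G where "\<And>w. length w = m + d \<Longrightarrow> augmented_RSK m w = G (rsk_path w)"
proof -
  have "\<exists>G. \<forall>w. length w = m + d \<longrightarrow> augmented_RSK m w = G (rsk_path w)"
  proof (induction d)
    case 0
    \<comment> \<open>When inserted, \<open>\<infinity>\<close> ends row \<open>0\<close>, so the
      current shape suffices.\<close>
    show ?case
      using augmented_RSK_length
      by (intro exI[of _ "\<lambda>\<gamma>. (last \<gamma>, (diagram_row_length (last \<gamma>) 0, 0))"]) auto
  next
    case (Suc d)
    then obtain G where G: "\<forall>w. length w = m + d \<longrightarrow> augmented_RSK m w = G (rsk_path w)" by blast
    have "augmented_RSK m w = next_augmented (G (butlast (rsk_path w))) (last (rsk_path w))"
      if w: "length w = m + Suc d" for w
    proof -
      obtain v a where "w = v @ [a]" using w by (cases w rule: rev_cases) auto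
      then show ?thesis using w G augmented_RSK_snoc[of m v a] by simp
    qed
    then show ?case
      by (intro exI[of _ "\<lambda>\<gamma>. next_augmented (G (butlast \<gamma>)) (last \<gamma>)"] allI impI)
  qed
  then obtain G where "\<forall>w. length w = m + d \<longrightarrow> augmented_RSK m w = G (rsk_path w)" ..
  then show ?thesis using that[of G] by simp
qed

subsection \<open>The Markov property\<close>

text \<open>Serves the shift of indices: the sample starts at index \<open>1\<close>, list positions
  at \<open>0\<close>.\<close>

lemma (in prob_space) indep_sets_reindex:
  assumes "inj_on f I" "indep_sets F (f ` I)"
  shows "indep_sets (\<lambda>i. F (f i)) I"
proof (rule indep_setsI)
  show "F (f i) \<subseteq> events" if "i \<in> I" for i
    using assms(2) that by (auto simp: indep_sets_def)
next
  fix A J assume J: "J \<noteq> {}" "J \<subseteq> I" "finite J" "\<forall>j\<in>J. A j \<in> F (f j)"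
  have inj: "inj_on f J" using assms(1) J(2) by (rule inj_on_subset)
  let ?A = "\<lambda>k. A (the_inv_into J f k)"
  have "prob (\<Inter>k\<in>f ` J. ?A k) = (\<Prod>k\<in>f ` J. prob (?A k))"
    using J by (intro indep_setsD[OF assms(2)]) (auto simp: the_inv_into_f_f[OF inj])
  then show "prob (\<Inter>j\<in>J. A j) = (\<Prod>j\<in>J. prob (A j))"
    by (simp add: prod.reindex[OF inj] the_inv_into_f_f[OF inj])
qed

lemma (in prob_space) indep_vars_reindex:
  assumes "inj_on f I" "indep_vars M' X (f ` I)"
  shows "indep_vars (\<lambda>i. M' (f i)) (\<lambda>i. X (f i)) I"
proof -
  have "indep_sets (\<lambda>i. {X (f i) -` A \<inter> space M |A. A \<in> sets (M' (f i))}) I"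
    using assms(2) unfolding indep_vars_def2 by (intro indep_sets_reindex[OF assms(1)]) simp
  then show ?thesis using assms(2) by (simp add: indep_vars_def2)
qed

lemma rsk_path_take: "i \<le> length w \<Longrightarrow> rsk_path (take i w) = take (Suc i) (rsk_path w)"
  by (auto simp: rsk_path_def take_map min_def simp del: upt_Suc intro!: map_cong)

lemma countable_augmented_diagrams: "countable augmented_diagrams"
proof (rule countable_subset)
  show "augmented_diagrams \<subseteq> {D. finite D} \<times> UNIV"
    by (auto simp: augmented_diagrams_def young_diagram_def)
  show "countable ({D :: box set. finite D} \<times> (UNIV :: box set))"
    using countable_Collect_finite by blast
qed

section \<open>Transition probabilities for a sequence of i.i.d. letters\<close>

locale iid_sequence = prob_space +
  fixes X :: "nat \<Rightarrow> 'a \<Rightarrow> real" and U :: "real measure"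
  assumes indep: "indep_vars (\<lambda>_. borel) X {..<n}"
    and distr: "distr M borel (X i) = U"
begin

definition word :: "nat \<Rightarrow> 'a \<Rightarrow> real list" where
  "word n \<omega> = map (\<lambda>i. X i \<omega>) [0..<n]"

lemma length_word [simp]: "length (word n \<omega>) = n"
  and word_Suc: "word (Suc n) \<omega> = word n \<omega> @ [X n \<omega>]"
  and take_word: "i \<le> n \<Longrightarrow> take i (word n \<omega>) = word i \<omega>"
  by (simp_all add: word_def take_map)

lemma measurable_path: "(\<lambda>\<omega>. rsk_path (word n \<omega>)) \<in> measurable M (count_space UNIV)"
proof -
  have "random_variable borel (X i)" if "i < n" for i
    using indep[of n] that by (auto simp: indep_vars_def)
  then have "(\<lambda>\<omega>. \<lambda>i\<in>{..<n}. X i \<omega>) \<in> measurable M (PiM {..<n} (\<lambda>_. borel))"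
    by (intro measurable_restrict) auto
  from measurable_compose[OF this measurable_rsk_path]
  have "(\<lambda>\<omega>. rsk_path (map (\<lambda>i\<in>{..<n}. X i \<omega>) [0..<n])) \<in> measurable M (count_space UNIV)" .
  moreover have "map (\<lambda>i\<in>{..<n}. X i \<omega>) [0..<n] = word n \<omega>" for \<omega> by (auto simp: word_def)
  ultimately show ?thesis by simp
qed

lemma path_event: "{\<omega> \<in> space M. Q (rsk_path (word n \<omega>))} \<in> events"
  by (rule measurable_sets_Collect[OF measurable_path]) simp

text \<open>All paths to \<open>D\<close> are equally likely, and \<open>c\<close> is their common
  probability. If no path reaches \<open>D\<close>, both sides vanish whatever \<open>c\<close>
  is.\<close>

lemma prob_path_eq_card:
  obtains c where "\<And>B. B \<subseteq> {\<gamma>. last \<gamma> = D} \<Longrightarrow>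
    \<P>(\<omega> in M. rsk_path (word n \<omega>) \<in> B) = c * real (card (B \<inter> young_paths n))"
proof -
  obtain c where c: "\<And>\<gamma>. \<gamma> \<in> young_paths n \<Longrightarrow> last \<gamma> = D \<Longrightarrow> \<P>(\<omega> in M. rsk_path (word n \<omega>) = \<gamma>) = c"
  proof (cases "\<exists>\<gamma>0\<in>young_paths n. last \<gamma>0 = D")
    case True
    then obtain \<gamma>0 where \<gamma>0: "\<gamma>0 \<in> young_paths n" "last \<gamma>0 = D" by blast
    have "\<P>(\<omega> in M. rsk_path (word n \<omega>) = \<gamma>) = \<P>(\<omega> in M. rsk_path (word n \<omega>) = \<gamma>0)"
      if "\<gamma> \<in> young_paths n" "last \<gamma> = D" for \<gamma>
      using prob_rsk_path_eq[OF indep distr that(1) \<gamma>0(1)] that(2) \<gamma>0(2) unfolding word_def by blast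
    then show ?thesis by (rule that)
  qed (use that in blast)
  show ?thesis
  proof (rule that[of c])
    fix B :: "box set list set" assume B: "B \<subseteq> {\<gamma>. last \<gamma> = D}"
    let ?E = "\<lambda>\<gamma>. {\<omega> \<in> space M. rsk_path (word n \<omega>) = \<gamma>}"
    have "{\<omega> \<in> space M. rsk_path (word n \<omega>) \<in> B} = (\<Union>\<gamma>\<in>B \<inter> young_paths n. ?E \<gamma>)"
      using rsk_path_in_young_paths[of "word n _"] by auto
    then have "\<P>(\<omega> in M. rsk_path (word n \<omega>) \<in> B) = prob (\<Union>\<gamma>\<in>B \<inter> young_paths n. ?E \<gamma>)" by simp
    also have "\<dots> = (\<Sum>\<gamma>\<in>B \<inter> young_paths n. prob (?E \<gamma>))"
      using finite_young_paths path_event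
      by (intro finite_measure_finite_Union) (auto simp: disjoint_family_on_def)
    also have "\<dots> = (\<Sum>\<gamma>\<in>B \<inter> young_paths n. c)"
      using c B by (intro sum.cong) auto
    finally show "\<P>(\<omega> in M. rsk_path (word n \<omega>) \<in> B) = c * real (card (B \<inter> young_paths n))" by simp
  qed
qed

text \<open>Along an edge, appending \<open>D'\<close> to the paths of \<open>B\<close> gives
  equally many paths, of common probability \<open>c'\<close>. Numerator and denominator are thus
  both multiples of the number of paths in \<open>B\<close>, and the ratio \<open>c' / c\<close> is
  the same for every \<open>B\<close>.\<close>

lemma cond_prob_RSK_Suc:
  assumes "B \<subseteq> {\<gamma>. last \<gamma> = D}" "\<P>(\<omega> in M. rsk_path (word n \<omega>) \<in> B) > 0"
  shows "\<P>(\<omega> in M. RSK (word (Suc n) \<omega>) = D' \<bar> rsk_path (word n \<omega>) \<in> B) =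
    \<P>(\<omega> in M. RSK (word (Suc n) \<omega>) = D' \<bar> RSK (word n \<omega>) = D)"
proof -
  obtain c where c: "\<And>B. B \<subseteq> {\<gamma>. last \<gamma> = D} \<Longrightarrow>
    \<P>(\<omega> in M. rsk_path (word n \<omega>) \<in> B) = c * real (card (B \<inter> young_paths n))"
    using prob_path_eq_card by blast
  obtain c' where c': "\<And>B. B \<subseteq> {\<gamma>. last \<gamma> = D'} \<Longrightarrow>
    \<P>(\<omega> in M. rsk_path (word (Suc n) \<omega>) \<in> B) = c' * real (card (B \<inter> young_paths (Suc n)))"
    using prob_path_eq_card by blast
  \<comment> \<open>Without an edge from \<open>D\<close> to \<open>D'\<close> the extended
    sequences are no paths and contribute nothing.\<close>
  define e where "e = (if young_edge D D' then c' else 0)"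
  have joint: "\<P>(\<omega> in M. RSK (word (Suc n) \<omega>) = D' \<and> rsk_path (word n \<omega>) \<in> B)
      = e * real (card (B \<inter> young_paths n))" if B: "B \<subseteq> {\<gamma>. last \<gamma> = D}" for B
  proof -
    let ?B = "(\<lambda>\<gamma>. \<gamma> @ [D']) ` B"
    have "\<P>(\<omega> in M. RSK (word (Suc n) \<omega>) = D' \<and> rsk_path (word n \<omega>) \<in> B)
        = \<P>(\<omega> in M. rsk_path (word (Suc n) \<omega>) \<in> ?B)"
      by (intro arg_cong[of _ _ prob]) (auto simp: word_Suc)
    also have "\<dots> = c' * real (card (?B \<inter> young_paths (Suc n)))"
      by (rule c') auto
    also have "?B \<inter> young_paths (Suc n)
        = (if young_edge D D' then (\<lambda>\<gamma>. \<gamma> @ [D']) ` (B \<inter> young_paths n) else {})"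
      using B by (auto simp: young_paths_snoc)
    also have "c' * real (card \<dots>) = e * real (card (B \<inter> young_paths n))"
      by (simp add: e_def card_image inj_on_def)
    finally show ?thesis .
  qed
  \<comment> \<open>Conditioning on the current shape is the case where \<open>B\<close> consists of
    all paths to \<open>D\<close>.\<close>
  have last: "RSK (word n \<omega>) = D \<longleftrightarrow> rsk_path (word n \<omega>) \<in> {\<gamma>. last \<gamma> = D}" for \<omega> by simp
  have pos: "c > 0" "card (B \<inter> young_paths n) > 0"
    using assms(2) c[OF assms(1)] by (auto simp: zero_less_mult_iff)
  have "card (B \<inter> young_paths n) \<le> card ({\<gamma>. last \<gamma> = D} \<inter> young_paths n)"
    using assms(1) finite_young_paths by (intro card_mono) auto
  then have "card ({\<gamma>. last \<gamma> = D} \<inter> young_paths n) > 0" using pos(2) by simp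
  then show ?thesis
    unfolding cond_prob_def last
    using pos joint[OF assms(1)] joint[of "{\<gamma>. last \<gamma> = D}"] c[OF assms(1)] c[of "{\<gamma>. last \<gamma> = D}"]
    by simp
qed

text \<open>Stated for any conditioning event \<open>Q\<close> that is decided by the path and fixes
  the current state, so that it covers both the present state alone and the whole history.\<close>

lemma cond_prob_augmented_RSK_Suc:
  assumes "m \<le> n" "\<And>\<omega>. \<omega> \<in> space M \<Longrightarrow> Q \<omega> \<longleftrightarrow> rsk_path (word n \<omega>) \<in> B"
    "\<And>\<omega>. \<omega> \<in> space M \<Longrightarrow> Q \<omega> \<Longrightarrow> augmented_RSK m (word n \<omega>) = L"
    "\<P>(\<omega> in M. Q \<omega>) > 0"
  shows "\<P>(\<omega> in M. augmented_RSK m (word (Suc n) \<omega>) = L' \<bar> Q \<omega>) =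
    (if augmented_edge L L'
     then \<P>(\<omega> in M. RSK (word (Suc n) \<omega>) = fst L' \<bar> RSK (word n \<omega>) = fst L) else 0)"
proof -
  have step: "augmented_RSK m (word (Suc n) \<omega>) = L'
      \<longleftrightarrow> augmented_edge L L' \<and> RSK (word (Suc n) \<omega>) = fst L'" if "\<omega> \<in> space M" "Q \<omega>" for \<omega>
  proof -
    have L: "augmented_RSK m (word n \<omega>) = L" using assms(3) that .
    have snoc: "augmented_RSK m (word (Suc n) \<omega>) = next_augmented L (RSK (word (Suc n) \<omega>))"
      using augmented_RSK_snoc[of m "word n \<omega>" "X n \<omega>"] assms(1) L by (simp add: word_Suc)
    have edge: "augmented_edge L (augmented_RSK m (word (Suc n) \<omega>))"
      using augmented_edge_RSK_snoc[of m "word n \<omega>" "X n \<omega>"] assms(1) L by (simp add: word_Suc)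
    show ?thesis
    proof
      assume "augmented_RSK m (word (Suc n) \<omega>) = L'"
      then show "augmented_edge L L' \<and> RSK (word (Suc n) \<omega>) = fst L'"
        using edge fst_augmented_RSK[of m "word (Suc n) \<omega>"] assms(1) by auto
    next
      assume *: "augmented_edge L L' \<and> RSK (word (Suc n) \<omega>) = fst L'"
      then have "L' = next_augmented L (fst L')"
        using augmented_edge_iff[of L L'] by (simp add: augmented_edge_def)
      then show "augmented_RSK m (word (Suc n) \<omega>) = L'" using snoc * by simp
    qed
  qed
  \<comment> \<open>Paths not ending in \<open>fst L\<close> do not occur under \<open>Q\<close>;
    discarding them makes \<open>B'\<close> admissible for \<open>cond_prob_RSK_Suc\<close>.\<close>
  define B' where "B' = B \<inter> {\<gamma>. last \<gamma> = fst L}"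
  have Q: "Q \<omega> \<longleftrightarrow> rsk_path (word n \<omega>) \<in> B'" if "\<omega> \<in> space M" for \<omega>
    using assms(2)[OF that] assms(3)[OF that] fst_augmented_RSK[of m "word n \<omega>"] assms(1)
    by (auto simp: B'_def)
  have QB: "{\<omega> \<in> space M. Q \<omega>} = {\<omega> \<in> space M. rsk_path (word n \<omega>) \<in> B'}" using Q by auto
  show ?thesis
  proof (cases "augmented_edge L L'")
    case True
    have "{\<omega> \<in> space M. augmented_RSK m (word (Suc n) \<omega>) = L' \<and> Q \<omega>}
        = {\<omega> \<in> space M. RSK (word (Suc n) \<omega>) = fst L' \<and> rsk_path (word n \<omega>) \<in> B'}"
      using step Q True by blast
    then have "\<P>(\<omega> in M. augmented_RSK m (word (Suc n) \<omega>) = L' \<bar> Q \<omega>)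
        = \<P>(\<omega> in M. RSK (word (Suc n) \<omega>) = fst L' \<bar> rsk_path (word n \<omega>) \<in> B')"
      unfolding cond_prob_def QB by simp
    also have "\<dots> = \<P>(\<omega> in M. RSK (word (Suc n) \<omega>) = fst L' \<bar> RSK (word n \<omega>) = fst L)"
      using assms(4) unfolding QB by (intro cond_prob_RSK_Suc) (auto simp: B'_def)
    finally show ?thesis using True by simp
  next
    case False
    then have "{\<omega> \<in> space M. augmented_RSK m (word (Suc n) \<omega>) = L' \<and> Q \<omega>} = {}"
      using step by blast
    then have "\<P>(\<omega> in M. augmented_RSK m (word (Suc n) \<omega>) = L' \<and> Q \<omega>) = 0" by (metis measure_empty)
    then show ?thesis using False by (simp add: cond_prob_def)
  qed
qed

lemma cond_prob_augmented_RSK: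
  assumes "m \<le> n" "\<P>(\<omega> in M. augmented_RSK m (word n \<omega>) = L) > 0"
  shows "\<P>(\<omega> in M. augmented_RSK m (word (Suc n) \<omega>) = L' \<bar> augmented_RSK m (word n \<omega>) = L) =
    (if augmented_edge L L'
     then \<P>(\<omega> in M. RSK (word (Suc n) \<omega>) = fst L' \<bar> RSK (word n \<omega>) = fst L) else 0)"
proof -
  obtain G where G: "\<And>w. length w = m + (n - m) \<Longrightarrow> augmented_RSK m w = G (rsk_path w)"
    using augmented_RSK_rsk_path by blast
  show ?thesis
    using assms G by (intro cond_prob_augmented_RSK_Suc[where B = "{\<gamma>. G \<gamma> = L}"]) auto
qed

text \<open>Earlier paths are prefixes of the present one, so the whole history is an event decided
  by the present path; the formula then gives the same value for both conditionings.\<close>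

lemma cond_prob_augmented_RSK_history:
  assumes "m \<le> n" "\<P>(\<omega> in M. \<forall>i\<in>{m..n}. augmented_RSK m (word i \<omega>) = s i) > 0"
  shows "\<P>(\<omega> in M. augmented_RSK m (word (Suc n) \<omega>) = L'
      \<bar> \<forall>i\<in>{m..n}. augmented_RSK m (word i \<omega>) = s i) =
    \<P>(\<omega> in M. augmented_RSK m (word (Suc n) \<omega>) = L' \<bar> augmented_RSK m (word n \<omega>) = s n)"
proof -
  have "\<exists>G. \<forall>w. length w = i \<longrightarrow> augmented_RSK m w = G (rsk_path w)" if "m \<le> i" for i
    using augmented_RSK_rsk_path[of m "i - m"] that by (metis le_add_diff_inverse)
  then obtain G where G: "\<And>i w. m \<le> i \<Longrightarrow> length w = i \<Longrightarrow> augmented_RSK m w = G i (rsk_path w)"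
    by metis
  have path: "augmented_RSK m (word i \<omega>) = G i (take (Suc i) (rsk_path (word n \<omega>)))"
    if "i \<in> {m..n}" for i \<omega>
    using that G[of i "word i \<omega>"] rsk_path_take[of i "word n \<omega>"] by (simp add: take_word)
  \<comment> \<open>The present event contains the history event, so it has positive probability as
    well and the formula applies to it.\<close>
  have "{\<omega> \<in> space M. \<forall>i\<in>{m..n}. augmented_RSK m (word i \<omega>) = s i}
      \<subseteq> {\<omega> \<in> space M. augmented_RSK m (word n \<omega>) = s n}" using assms(1) by auto
  moreover have "{\<omega> \<in> space M. augmented_RSK m (word n \<omega>) = s n} \<in> events"
    using path_event[of "\<lambda>\<gamma>. G n \<gamma> = s n" n] G[OF assms(1)] by simp
  ultimately have "\<P>(\<omega> in M. \<forall>i\<in>{m..n}. augmented_RSK m (word i \<omega>) = s i)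
      \<le> \<P>(\<omega> in M. augmented_RSK m (word n \<omega>) = s n)" by (rule finite_measure_mono)
  then have pos: "\<P>(\<omega> in M. augmented_RSK m (word n \<omega>) = s n) > 0" using assms(2) by simp
  have "\<P>(\<omega> in M. augmented_RSK m (word (Suc n) \<omega>) = L'
      \<bar> \<forall>i\<in>{m..n}. augmented_RSK m (word i \<omega>) = s i) =
    (if augmented_edge (s n) L'
     then \<P>(\<omega> in M. RSK (word (Suc n) \<omega>) = fst L' \<bar> RSK (word n \<omega>) = fst (s n)) else 0)"
  proof (rule cond_prob_augmented_RSK_Suc[OF assms(1) _ _ assms(2)])
    show "(\<forall>i\<in>{m..n}. augmented_RSK m (word i \<omega>) = s i)
        \<longleftrightarrow> rsk_path (word n \<omega>) \<in> {\<gamma>. \<forall>i\<in>{m..n}. G i (take (Suc i) \<gamma>) = s i}" for \<omega>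
      using path by simp
  qed (use assms(1) in auto)
  then show ?thesis unfolding cond_prob_augmented_RSK[OF assms(1) pos] .
qed

text \<open>\<open>Y\<close> is tied to the words from time \<open>m\<close> on only: before
  \<open>m\<close>, the definition of the augmented process already uses all \<open>m\<close>
  letters.\<close>

lemma markov_chain_augmented_RSK:
  assumes "\<And>t \<omega>. m \<le> t \<Longrightarrow> Y t \<omega> = augmented_RSK m (word t \<omega>)"
  shows "markov_chain_from M augmented_diagrams m Y"
  unfolding markov_chain_from_def
proof (intro conjI allI ballI impI)
  show "countable augmented_diagrams" by (rule countable_augmented_diagrams)
next
  fix t assume t: "m \<le> t"
  obtain G where G: "\<And>w. length w = m + (t - m) \<Longrightarrow> augmented_RSK m w = G (rsk_path w)"
    using augmented_RSK_rsk_path by blast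
  have "Y t -` {L} \<inter> space M \<in> events" for L
    using path_event[of "\<lambda>\<gamma>. G \<gamma> = L" t] G[of "word t _"] t assms[OF t]
    by (simp add: vimage_def Int_def conj_commute)
  moreover have "Y t \<omega> \<in> augmented_diagrams" for \<omega>
    using augmented_RSK_in_augmented_diagrams[of m "word t \<omega>"] t assms[OF t] by simp
  ultimately show "Y t \<in> measurable M (count_space augmented_diagrams)"
    by (subst measurable_count_space_eq_countable) (auto simp: countable_augmented_diagrams)
next
  fix t s assume t: "m \<le> t" and pos: "0 < \<P>(\<omega> in M. \<forall>i\<in>{m..t}. Y i \<omega> = s i)"
  have hist: "(\<forall>i\<in>{m..t}. Y i \<omega> = s i) \<longleftrightarrow> (\<forall>i\<in>{m..t}. augmented_RSK m (word i \<omega>) = s i)" for \<omega>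
    using assms by auto
  show "\<P>(\<omega> in M. Y (Suc t) \<omega> = s (Suc t) \<bar> \<forall>i\<in>{m..t}. Y i \<omega> = s i) =
      \<P>(\<omega> in M. Y (Suc t) \<omega> = s (Suc t) \<bar> Y t \<omega> = s t)"
    using cond_prob_augmented_RSK_history[OF t] pos t assms unfolding hist by simp
qed

end

lemma iid_sequence_Suc:
  assumes "iid_uniform M \<xi>"
  shows "iid_sequence M (\<lambda>i. \<xi> (Suc i)) (uniform_measure lborel {0..1})"
proof -
  interpret prob_space M using assms by (simp add: iid_uniform_def)
  show ?thesis
  proof
    fix n
    have "indep_vars (\<lambda>_. borel) \<xi> (Suc ` {..<n})"
      by (rule indep_vars_subset[of _ \<xi> "{1..}"]) (use assms in \<open>auto simp: iid_uniform_def\<close>)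
    then show "indep_vars (\<lambda>_. borel) (\<lambda>i. \<xi> (Suc i)) {..<n}"
      using indep_vars_reindex[of Suc "{..<n}" "\<lambda>_. borel" \<xi>] by simp
  next
    show "distr M borel (\<xi> (Suc i)) = uniform_measure lborel {0..1}" for i
      using assms by (simp add: iid_uniform_def)
  qed
qed

theorem theorem3p5:
  fixes M :: "'a measure" and \<xi> :: "nat \<Rightarrow> 'a \<Rightarrow> real"
  assumes "iid_uniform M \<xi>"
  shows
    "(\<forall>m. markov_chain_from M augmented_diagrams m (augmented_plancherel_growth \<xi> m) \<and>
       (\<forall>t\<ge>m. \<forall>L\<in>augmented_diagrams. \<forall>L'\<in>augmented_diagrams.
          \<P>(\<omega> in M. augmented_plancherel_growth \<xi> m t \<omega> = L) > 0 \<longrightarrow>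
          \<P>(\<omega> in M. augmented_plancherel_growth \<xi> m (Suc t) \<omega> = L'
               \<bar> augmented_plancherel_growth \<xi> m t \<omega> = L) =
          (if augmented_edge L L'
           then \<P>(\<omega> in M. plancherel_growth \<xi> (Suc t) \<omega> = fst L'
                    \<bar> plancherel_growth \<xi> t \<omega> = fst L)
           else 0))) \<and>
     (\<forall>m m' t. \<forall>L\<in>augmented_diagrams. \<forall>L'\<in>augmented_diagrams.
        m \<le> t \<longrightarrow> m' \<le> t \<longrightarrow>
        \<P>(\<omega> in M. augmented_plancherel_growth \<xi> m t \<omega> = L) > 0 \<longrightarrow>
        \<P>(\<omega> in M. augmented_plancherel_growth \<xi> m' t \<omega> = L) > 0 \<longrightarrow>
        \<P>(\<omega> in M. augmented_plancherel_growth \<xi> m (Suc t) \<omega> = L'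
             \<bar> augmented_plancherel_growth \<xi> m t \<omega> = L) =
        \<P>(\<omega> in M. augmented_plancherel_growth \<xi> m' (Suc t) \<omega> = L'
             \<bar> augmented_plancherel_growth \<xi> m' t \<omega> = L))"
proof -
  interpret iid_sequence M "\<lambda>i. \<xi> (Suc i)" "uniform_measure lborel {0..1}"
    using iid_sequence_Suc[OF assms] .
  have word: "map (\<lambda>i. \<xi> i \<omega>) [1..<Suc n] = word n \<omega>" for n \<omega>
    by (simp add: word_def map_Suc_upt[symmetric] comp_def del: upt_Suc)
  have growth: "plancherel_growth \<xi> n \<omega> = RSK (word n \<omega>)" for n \<omega>
    unfolding plancherel_growth_def word ..
  have aug: "augmented_plancherel_growth \<xi> m t \<omega> = augmented_RSK m (word t \<omega>)" if "m \<le> t" for m t \<omega>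
  proof -
    have split: "[1..<Suc t] = [1..<Suc m] @ [Suc m..<Suc t]"
      using that upt_add_eq_append[of 1 "Suc m" "t - m"] by simp
    have "take m (word t \<omega>) = map (\<lambda>i. \<xi> i \<omega>) [1..<Suc m]"
      "drop m (word t \<omega>) = map (\<lambda>i. \<xi> i \<omega>) [Suc m..<Suc t]"
      unfolding word[symmetric] split by (simp_all del: upt_Suc)
    then show ?thesis
      by (simp add: augmented_plancherel_growth_def augmented_RSK_def comp_def del: upt_Suc)
  qed
  have "\<P>(\<omega> in M. augmented_plancherel_growth \<xi> m (Suc t) \<omega> = L'
               \<bar> augmented_plancherel_growth \<xi> m t \<omega> = L) =
          (if augmented_edge L L'
           then \<P>(\<omega> in M. plancherel_growth \<xi> (Suc t) \<omega> = fst L'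
                    \<bar> plancherel_growth \<xi> t \<omega> = fst L)
           else 0)"
    if "m \<le> t" "\<P>(\<omega> in M. augmented_plancherel_growth \<xi> m t \<omega> = L) > 0" for m t L L'
    using cond_prob_augmented_RSK[OF that(1)] that by (simp add: aug growth)
  moreover have "markov_chain_from M augmented_diagrams m (augmented_plancherel_growth \<xi> m)" for m
    using aug by (rule markov_chain_augmented_RSK)
  \<comment> \<open>The right-hand side of the formula does not mention \<open>m\<close>, which
    gives the independence of \<open>m\<close>.\<close>
  ultimately show ?thesis by simp
qed

end
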